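(* Let $H\colon\mathbb{R}^2\to\mathbb{R}$ be a nonzero homogeneous polynomial of degree $4$, let $\mathsf{H}$ be the symmetric $4$-linear form on $\mathbb{R}^2$ with $H(x)=\frac{1}{4!}\mathsf{H}(x,x,x,x)$, let $K$ be an invertible antisymmetric $2\times2$ real matrix, and let $h\ne0$. Then the polar map on $\mathbb{R}^2\times\mathbb{R}^2$ associated with the Hamiltonian vector field $\dot x=K\nabla H(x)$, namely $(x_0,x_1)\mapsto(x_1,x_2)$ where $x_2$ is the solution of $$\frac{x_2-x_0}{2h}=\frac{1}{3!}K\,\mathsf{H}(x_0,x_1,x_2,\cdot),$$ is completely integrable.
   Context: $\mathsf{H}(x_0,x_1,x_2,\cdot)$ denotes the linear functional $v\mapsto\mathsf{H}(x_0,x_1,x_2,v)$, identified with a column vector in $\mathbb{R}^2$ via the standard inner product. The polar map is a birational map of $\mathbb{R}^4=\mathbb{R}^2\times\mathbb{R}^2$, considered where the linear system for $x_2$ is uniquely solvable. Completely integrable is meant in the following sense: the second iterate $\psi$ of the map (a) commutes with a $1$-dimensional Lie group of transformations and preserves a measure that is also invariant under this group, so that $\psi$ descends to a measure-preserving map of the $3$-dimensional quotient (on a dense open set); (b) has two functionally independent integrals (functions invariant under $\psi$) that are invariant under the group, and hence descend to integrals of the quotient map; and (c) the reconstruction dynamics along the group orbits, over a given orbit of the quotient map, obey a $1$-dimensional, linear, constant-coefficient, nonautonomous difference equation. (A $3$-dimensional measure-preserving map with two independent integrals is regarded as integrable.) *)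

theory Defs
  imports "HOL-Analysis.Analysis"
begin

section \<open>Homogeneous polynomials, polarization, and the polar map\<close>

definition homogeneous_polynomial :: "nat \<Rightarrow> (real^2 \<Rightarrow> real) \<Rightarrow> bool" where
  "homogeneous_polynomial d H \<longleftrightarrow>
     (\<exists>c :: nat \<Rightarrow> real. \<forall>x. H x = (\<Sum>k\<le>d. c k * (x $ 1) ^ k * (x $ 2) ^ (d - k)))"

text \<open>Invariance under the three adjacent transpositions gives invariance under all
  permutations of the arguments, and hence linearity in every slot.\<close>

definition symmetric_4linear ::
  "(real^2 \<Rightarrow> real^2 \<Rightarrow> real^2 \<Rightarrow> real^2 \<Rightarrow> real) \<Rightarrow> bool" where
  "symmetric_4linear HH \<longleftrightarrow>
     (\<forall>b c d. linear (\<lambda>a. HH a b c d)) \<and>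
     (\<forall>a b c d. HH a b c d = HH b a c d) \<and>
     (\<forall>a b c d. HH a b c d = HH a c b d) \<and>
     (\<forall>a b c d. HH a b c d = HH a b d c)"

text \<open>For linear \<open>L\<close>, the vector representing \<open>L\<close> in the standard inner product.\<close>

definition covector :: "(real^2 \<Rightarrow> real) \<Rightarrow> real^2" where
  "covector L = (\<chi> i. L (axis i 1))"

type_synonym phase = "(real^2) \<times> (real^2)"

definition polar_eq ::
  "real \<Rightarrow> real^2^2 \<Rightarrow> (real^2 \<Rightarrow> real^2 \<Rightarrow> real^2 \<Rightarrow> real^2 \<Rightarrow> real)
    \<Rightarrow> real^2 \<Rightarrow> real^2 \<Rightarrow> real^2 \<Rightarrow> bool" where
  "polar_eq h K HH x0 x1 x2 \<longleftrightarrow>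
     (1 / (2 * h)) *\<^sub>R (x2 - x0) = (1 / fact 3) *\<^sub>R (K *v covector (\<lambda>v. HH x0 x1 x2 v))"

definition polar_dom ::
  "real \<Rightarrow> real^2^2 \<Rightarrow> (real^2 \<Rightarrow> real^2 \<Rightarrow> real^2 \<Rightarrow> real^2 \<Rightarrow> real) \<Rightarrow> phase set" where
  "polar_dom h K HH = {(x0, x1). \<exists>!x2. polar_eq h K HH x0 x1 x2}"

definition polar_map ::
  "real \<Rightarrow> real^2^2 \<Rightarrow> (real^2 \<Rightarrow> real^2 \<Rightarrow> real^2 \<Rightarrow> real^2 \<Rightarrow> real) \<Rightarrow> phase \<Rightarrow> phase" where
  "polar_map h K HH = (\<lambda>(x0, x1). (x1, THE x2. polar_eq h K HH x0 x1 x2))"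


section \<open>Smooth functions\<close>

text \<open>Intended for open \<open>S\<close>: \<open>Ck_on k S f\<close> says that \<open>f\<close> is of class \<open>C\<^sup>k\<close> on \<open>S\<close>.\<close>

primrec Ck_on :: "nat \<Rightarrow> 'a::euclidean_space set \<Rightarrow> ('a \<Rightarrow> 'b::real_normed_vector) \<Rightarrow> bool" where
  "Ck_on 0 S f \<longleftrightarrow> continuous_on S f"
| "Ck_on (Suc k) S f \<longleftrightarrow>
     (\<exists>f'. (\<forall>x\<in>S. (f has_derivative f' x) (at x)) \<and> (\<forall>v. Ck_on k S (\<lambda>x. f' x v)))"

definition smooth_on :: "'a::euclidean_space set \<Rightarrow> ('a \<Rightarrow> 'b::real_normed_vector) \<Rightarrow> bool" where
  "smooth_on S f \<longleftrightarrow> (\<forall>k. Ck_on k S f)"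

text \<open>The differentials are linearly independent on a dense subset of \<open>U\<close>.\<close>

definition functionally_independent_on ::
  "'a::euclidean_space set \<Rightarrow> ('a \<Rightarrow> real) \<Rightarrow> ('a \<Rightarrow> real) \<Rightarrow> bool" where
  "functionally_independent_on U f g \<longleftrightarrow>
     U \<subseteq> closure {p \<in> U. \<forall>a b. (\<forall>v. a * frechet_derivative f (at p) v
                                 + b * frechet_derivative g (at p) v = 0) \<longrightarrow> a = 0 \<and> b = 0}"


section \<open>Partially defined maps and invariant measures\<close>

text \<open>A partially defined map is a pair of a domain \<open>D\<close> and a function \<open>f\<close>, whose values outside
  \<open>D\<close> are irrelevant.\<close>

definition second_iterate_dom :: "'a set \<Rightarrow> ('a \<Rightarrow> 'a) \<Rightarrow> 'a set" where
  "second_iterate_dom D f = {p \<in> D. f p \<in> D}"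

definition dom_within :: "'a set \<Rightarrow> 'a set \<Rightarrow> ('a \<Rightarrow> 'a) \<Rightarrow> 'a set" where
  "dom_within U D f = {p \<in> U \<inter> D. f p \<in> U}"

text \<open>Images rather than preimages are used because \<open>f\<close> is only considered on \<open>W\<close>.\<close>

definition measure_preserving_on :: "'a measure \<Rightarrow> 'a set \<Rightarrow> ('a \<Rightarrow> 'a) \<Rightarrow> bool" where
  "measure_preserving_on M W f \<longleftrightarrow> inj_on f W \<and>
     (\<forall>A\<in>sets M. A \<subseteq> W \<longrightarrow> f ` A \<in> sets M \<and> emeasure M (f ` A) = emeasure M A)"

definition measure_with_density :: "phase set \<Rightarrow> (phase \<Rightarrow> real) \<Rightarrow> phase measure" where
  "measure_with_density U m = density lborel (\<lambda>p. ennreal (m p) * indicator U p)"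


section \<open>One-parameter symmetry groups and their quotients\<close>

text \<open>The one-dimensional Lie group is taken to be the additive group of the reals, so that the
  group coordinate along an orbit can satisfy a linear difference equation. The group coordinate
  below makes the action free on \<open>U\<close>, so the group of transformations is one-dimensional.\<close>

definition one_parameter_group :: "(real \<Rightarrow> phase \<Rightarrow> phase) \<Rightarrow> bool" where
  "one_parameter_group \<Phi> \<longleftrightarrow>
     smooth_on UNIV (\<lambda>(t, p). \<Phi> t p) \<and>
     (\<forall>p. \<Phi> 0 p = p) \<and> (\<forall>s t p. \<Phi> (s + t) p = \<Phi> s (\<Phi> t p))"

text \<open>\<open>\<pi>\<close> realizes the orbit space of a dense open invariant set \<open>U\<close> as the open subset
  \<open>\<pi> ` U\<close> of three-dimensional space: it is a submersion whose fibres are the group orbits.\<close>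

definition quotient_projection ::
  "(real \<Rightarrow> phase \<Rightarrow> phase) \<Rightarrow> phase set \<Rightarrow> (phase \<Rightarrow> real^3) \<Rightarrow> bool" where
  "quotient_projection \<Phi> U \<pi> \<longleftrightarrow>
     open U \<and> closure U = UNIV \<and> (\<forall>t. \<forall>p\<in>U. \<Phi> t p \<in> U) \<and>
     smooth_on U \<pi> \<and> (\<forall>p\<in>U. surj (frechet_derivative \<pi> (at p))) \<and>
     (\<forall>p\<in>U. \<forall>q\<in>U. \<pi> p = \<pi> q \<longleftrightarrow> (\<exists>t. q = \<Phi> t p))"

definition group_coordinate ::
  "(real \<Rightarrow> phase \<Rightarrow> phase) \<Rightarrow> phase set \<Rightarrow> (phase \<Rightarrow> real) \<Rightarrow> bool" where
  "group_coordinate \<Phi> U \<tau> \<longleftrightarrow> smooth_on U \<tau> \<and> (\<forall>t. \<forall>p\<in>U. \<tau> (\<Phi> t p) = \<tau> p + t)"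

text \<open>For \<open>\<mu>\<close> invariant under the group, the measure induced on the quotient is the measure of
  unit-length pieces of the orbits: in the coordinates \<open>(\<pi>, \<tau>)\<close>, \<open>\<mu>\<close> is the product of
  the measure below with Lebesgue measure.\<close>

definition quotient_measure ::
  "phase measure \<Rightarrow> phase set \<Rightarrow> (phase \<Rightarrow> real^3) \<Rightarrow> (phase \<Rightarrow> real) \<Rightarrow> (real^3) measure" where
  "quotient_measure \<mu> U \<pi> \<tau> = distr (restrict_space \<mu> {p \<in> U. 0 \<le> \<tau> p \<and> \<tau> p < 1}) borel \<pi>"


section \<open>Complete integrability\<close>

text \<open>An orbit, indexed by an interval \<open>I\<close> of integers, of the map \<open>f\<close> with domain \<open>W\<close>;
  orbits of a partially defined map may be finite, one-sided or two-sided.\<close>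

definition orbit_of :: "int set \<Rightarrow> 'a set \<Rightarrow> ('a \<Rightarrow> 'a) \<Rightarrow> (int \<Rightarrow> 'a) \<Rightarrow> bool" where
  "orbit_of I W f q \<longleftrightarrow> (\<forall>i\<in>I. \<forall>j\<in>I. {i..j} \<subseteq> I) \<and>
     (\<forall>n. n \<in> I \<and> n + 1 \<in> I \<longrightarrow> q n \<in> W \<and> q (n + 1) = f (q n))"

text \<open>The coefficient \<open>a\<close> is constant; the inhomogeneity \<open>b\<close> depends on the time \<open>n\<close> and on
  the given orbit \<open>q\<close> of the quotient map, but not on the orbit \<open>p\<close> lying over it.\<close>

definition linear_reconstruction ::
  "phase set \<Rightarrow> (phase \<Rightarrow> real^3) \<Rightarrow> (phase \<Rightarrow> real) \<Rightarrow> phase set \<Rightarrow> (phase \<Rightarrow> phase)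
    \<Rightarrow> (real^3 \<Rightarrow> real^3) \<Rightarrow> bool" where
  "linear_reconstruction U \<pi> \<tau> W \<psi> \<psi>q \<longleftrightarrow>
     (\<exists>a :: real. \<forall>I q. orbit_of I (\<pi> ` W) \<psi>q q \<longrightarrow>
       (\<exists>b :: int \<Rightarrow> real. \<forall>p. orbit_of I W \<psi> p \<and> (\<forall>n\<in>I. p n \<in> U \<and> \<pi> (p n) = q n) \<longrightarrow>
          (\<forall>n. n \<in> I \<and> n + 1 \<in> I \<longrightarrow> \<tau> (p (n + 1)) = a * \<tau> (p n) + b n)))"

text \<open>\<open>Iq\<close> is the integral of the quotient map to which \<open>J\<close> descends.\<close>

definition invariant_integral ::
  "(real \<Rightarrow> phase \<Rightarrow> phase) \<Rightarrow> phase set \<Rightarrow> (phase \<Rightarrow> real^3) \<Rightarrow> phase set \<Rightarrow> (phase \<Rightarrow> phase)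
    \<Rightarrow> (real^3 \<Rightarrow> real^3) \<Rightarrow> (phase \<Rightarrow> real) \<Rightarrow> bool" where
  "invariant_integral \<Phi> U \<pi> W \<psi> \<psi>q J \<longleftrightarrow>
     smooth_on U J \<and>
     (\<forall>p\<in>W. J (\<psi> p) = J p) \<and>
     (\<forall>t. \<forall>p\<in>U. J (\<Phi> t p) = J p) \<and>
     (\<exists>Iq. (\<forall>p\<in>U. J p = Iq (\<pi> p)) \<and> (\<forall>q\<in>\<pi> ` W. Iq (\<psi>q q) = Iq q))"

text \<open>\<open>W\<close> is the set of points of \<open>U\<close> where \<open>\<psi>\<close> is defined and takes values in \<open>U\<close>. Its density
  ensures that the conditions imposed on \<open>W\<close> only are not vacuous, and that the quotient map
  \<open>\<psi>q\<close> is defined on a dense open subset of the quotient.\<close>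

definition completely_integrable :: "phase set \<Rightarrow> (phase \<Rightarrow> phase) \<Rightarrow> bool" where
  "completely_integrable D \<phi> \<longleftrightarrow>
    (\<exists>\<Phi> U m \<pi> \<tau> \<psi>q J1 J2.
      let \<psi> = \<phi> \<circ> \<phi>;
          D2 = second_iterate_dom D \<phi>;
          W = dom_within U D2 \<psi>;
          \<mu> = measure_with_density U m
      in
        one_parameter_group \<Phi> \<and>
        (\<forall>t. \<forall>p\<in>D2. \<Phi> t p \<in> D2 \<and> \<psi> (\<Phi> t p) = \<Phi> t (\<psi> p)) \<and>
        quotient_projection \<Phi> U \<pi> \<and>
        group_coordinate \<Phi> U \<tau> \<and>
        open W \<and> closure W = UNIV \<and>
        smooth_on U m \<and> (\<forall>p\<in>U. 0 < m p) \<and>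
        measure_preserving_on \<mu> W \<psi> \<and>
        (\<forall>t. measure_preserving_on \<mu> U (\<Phi> t)) \<and>
        (\<forall>p\<in>W. \<pi> (\<psi> p) = \<psi>q (\<pi> p)) \<and>
        measure_preserving_on (quotient_measure \<mu> U \<pi> \<tau>) (\<pi> ` W) \<psi>q \<and>
        invariant_integral \<Phi> U \<pi> W \<psi> \<psi>q J1 \<and>
        invariant_integral \<Phi> U \<pi> W \<psi> \<psi>q J2 \<and>
        functionally_independent_on U J1 J2 \<and>
        linear_reconstruction U \<pi> \<tau> W \<psi> \<psi>q)"

end

theory Submission
  imports Defs
begin

text \<open>Write \<open>\<omega>\<close> for the standard area form and \<open>x\<^sub>0, x\<^sub>1, \<dots>\<close> for an orbit. After a rescaling of \<open>HH\<close> the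
  polar equation reads \<open>\<omega> (x\<^sub>2 - x\<^sub>0) v = HH x\<^sub>0 x\<^sub>1 x\<^sub>2 v\<close>, that is, \<open>x\<^sub>2 - x\<^sub>0 = M x\<^sub>2\<close> with a matrix
  \<open>M = M (x\<^sub>0, x\<^sub>1)\<close> in \<open>sl\<^sub>2\<close>, so \<open>M\<^sup>2\<close> is scalar and \<open>x\<^sub>2\<close> is explicit. The equation is invariant under
  \<open>(x\<^sub>0, x\<^sub>1, x\<^sub>2) \<mapsto> (s x\<^sub>0, s\<^sup>-\<^sup>1 x\<^sub>1, s x\<^sub>2)\<close>, so the second iterate commutes with the group
  \<open>(x\<^sub>0, x\<^sub>1) \<mapsto> (e\<^sup>t x\<^sub>0, e\<^sup>-\<^sup>t x\<^sub>1)\<close>. Expressing both \<open>x\<^sub>0\<close> and \<open>x\<^sub>3\<close> through \<open>M (x\<^sub>1, x\<^sub>2)\<close> gives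
  \<open>\<omega> x\<^sub>0 x\<^sub>1 = \<omega> x\<^sub>2 x\<^sub>3\<close>, so \<open>\<omega> x\<^sub>0 x\<^sub>1\<close> and \<open>\<omega> x\<^sub>1 x\<^sub>2\<close> are integrals of the second iterate. By implicit
  differentiation, using the symmetry of \<open>HH\<close>, the density \<open>1 / \<bar>det (1 - M (x\<^sub>0, x\<^sub>1))\<bar>\<close> is invariant.
  A map that commutes with the group shifts the group coordinate of an orbit by a constant, which
  makes the reconstruction equation linear with coefficient \<open>1\<close>.\<close>

subsection \<open>Smooth functions\<close>

lemma Ck_on_continuous_on: "Ck_on k S f \<Longrightarrow> continuous_on S f"

  \<comment> \<open>Closure rules for functions of class \<open>C^k\<close>\<close>
  by (cases k) (auto intro!: continuous_at_imp_continuous_on intro: has_derivative_continuous)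

lemma Ck_on_SucD: "Ck_on (Suc k) S f \<Longrightarrow> Ck_on k S f"
proof (induction k arbitrary: f)
  case 0
  then show ?case using Ck_on_continuous_on[of "Suc 0" S f] by simp
next
  case (Suc k)
  then obtain f' where "\<forall>x\<in>S. (f has_derivative f' x) (at x)" "\<forall>v. Ck_on (Suc k) S (\<lambda>x. f' x v)"
    by (metis Ck_on.simps(2))
  with Suc.IH show ?case by (metis Ck_on.simps(2))
qed

lemma Ck_on_const: "Ck_on k S (\<lambda>x. c)"
proof (induction k arbitrary: c)
  case (Suc k)
  show ?case unfolding Ck_on.simps
    by (intro exI[of _ "\<lambda>x v. 0"] conjI allI ballI Suc) simp
qed simp

lemma Ck_on_bounded_linear: "bounded_linear f \<Longrightarrow> Ck_on k S f"
proof (cases k)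
  case (Suc k)
  assume "bounded_linear f"
  then show ?thesis unfolding Suc Ck_on.simps
    by (intro exI[of _ "\<lambda>x. f"] conjI allI ballI Ck_on_const bounded_linear_imp_has_derivative)
qed (auto intro: linear_continuous_on)

lemma Ck_on_add: "Ck_on k S f \<Longrightarrow> Ck_on k S g \<Longrightarrow> Ck_on k S (\<lambda>x. f x + g x)"
proof (induction k arbitrary: f g)
  case (Suc k)
  then obtain f' g' where "\<forall>x\<in>S. (f has_derivative f' x) (at x)" "\<forall>v. Ck_on k S (\<lambda>x. f' x v)"
    "\<forall>x\<in>S. (g has_derivative g' x) (at x)" "\<forall>v. Ck_on k S (\<lambda>x. g' x v)" by auto
  then show ?case unfolding Ck_on.simps
    by (intro exI[of _ "\<lambda>x v. f' x v + g' x v"] conjI allI ballI Suc has_derivative_add) auto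
qed (auto intro: continuous_intros)

lemma Ck_on_scaleR:
  fixes f :: "'a::euclidean_space \<Rightarrow> real"
  shows "Ck_on k S f \<Longrightarrow> Ck_on k S g \<Longrightarrow> Ck_on k S (\<lambda>x. f x *\<^sub>R g x)"
proof (induction k arbitrary: f g)
  case (Suc k)
  then obtain f' g' where "\<forall>x\<in>S. (f has_derivative f' x) (at x)" "\<forall>v. Ck_on k S (\<lambda>x. f' x v)"
    "\<forall>x\<in>S. (g has_derivative g' x) (at x)" "\<forall>v. Ck_on k S (\<lambda>x. g' x v)" by auto
  moreover have "Ck_on k S f" "Ck_on k S g" using Suc.prems Ck_on_SucD by blast+
  ultimately show ?case unfolding Ck_on.simps
    by (intro exI[of _ "\<lambda>x v. f x *\<^sub>R g' x v + f' x v *\<^sub>R g x"] conjI allI ballI Suc.IH Ck_on_add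
        has_derivative_scaleR) auto
qed (auto intro: continuous_intros)

lemma Ck_on_mult:
  fixes f g :: "'a::euclidean_space \<Rightarrow> real"
  shows "Ck_on k S f \<Longrightarrow> Ck_on k S g \<Longrightarrow> Ck_on k S (\<lambda>x. f x * g x)"
  using Ck_on_scaleR[of k S f g] by simp

lemma Ck_on_linear_compose:
  assumes L: "bounded_linear L"
  shows "Ck_on k S f \<Longrightarrow> Ck_on k S (\<lambda>x. L (f x))"
proof (induction k arbitrary: f)
  case 0
  then show ?case using continuous_on_compose2[OF linear_continuous_on[OF L, of UNIV], of S f] by auto
next
  case (Suc k)
  then obtain f' where "\<forall>x\<in>S. (f has_derivative f' x) (at x)" "\<forall>v. Ck_on k S (\<lambda>x. f' x v)"
    by auto
  then show ?case unfolding Ck_on.simps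
    by (intro exI[of _ "\<lambda>x v. L (f' x v)"] conjI allI ballI Suc.IH bounded_linear.has_derivative[OF L]) auto
qed

text \<open>The derivative contains \<open>inverse (f x)\<close> again. The induction closes because
  \<open>Ck_on_SucD\<close> makes \<open>f\<close> of class \<open>k\<close>, so the induction
  hypothesis covers this factor.\<close>

lemma Ck_on_inverse:
  fixes f :: "'a::euclidean_space \<Rightarrow> real"
  assumes "\<And>x. x \<in> S \<Longrightarrow> f x \<noteq> 0"
  shows "Ck_on k S f \<Longrightarrow> Ck_on k S (\<lambda>x. inverse (f x))"
proof (induction k)
  case 0
  then show ?case using assms by (auto intro: continuous_intros)
next
  case (Suc k)
  then obtain f' where f': "\<forall>x\<in>S. (f has_derivative f' x) (at x)" "\<forall>v. Ck_on k S (\<lambda>x. f' x v)"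
    by auto
  have "Ck_on k S (\<lambda>x. inverse (f x))" using Suc Ck_on_SucD by blast
  then have "Ck_on k S (\<lambda>x. (-1) * (inverse (f x) * f' x v * inverse (f x)))" for v
    using f' by (intro Ck_on_mult Ck_on_const) auto
  with f' assms show ?case unfolding Ck_on.simps
    by (intro exI[of _ "\<lambda>x v. - (inverse (f x) * f' x v * inverse (f x))"] conjI allI ballI
        Deriv.has_derivative_inverse) auto
qed

lemma Ck_on_exp:
  fixes f :: "'a::euclidean_space \<Rightarrow> real"
  shows "Ck_on k S f \<Longrightarrow> Ck_on k S (\<lambda>x. exp (f x))"
proof (induction k)
  case (Suc k)
  then obtain f' where f': "\<forall>x\<in>S. (f has_derivative f' x) (at x)" "\<forall>v. Ck_on k S (\<lambda>x. f' x v)"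
    by auto
  have "Ck_on k S (\<lambda>x. exp (f x))" using Suc Ck_on_SucD by blast
  with f' show ?case unfolding Ck_on.simps
    by (intro exI[of _ "\<lambda>x v. exp (f x) * f' x v"] conjI allI ballI Ck_on_mult)
      (auto intro!: derivative_eq_intros)
qed (auto intro: continuous_intros)

text \<open>Away from zero \<open>sgn\<close> is locally constant, so the composite has derivative
  zero and all further orders are trivial.\<close>

lemma Ck_on_sgn:
  fixes f :: "'a::euclidean_space \<Rightarrow> real"
  assumes "\<And>x. x \<in> S \<Longrightarrow> f x \<noteq> 0"
  shows "Ck_on k S f \<Longrightarrow> Ck_on k S (\<lambda>x. sgn (f x))"
proof (cases k)
  case 0
  assume "Ck_on k S f"
  then show ?thesis using assms 0 by (auto intro: continuous_on_sgn)
next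
  case (Suc n)
  assume "Ck_on k S f"
  then obtain f' where f': "\<forall>x\<in>S. (f has_derivative f' x) (at x)"
    using Suc by auto
  have sgn: "(sgn has_derivative (\<lambda>_. 0)) (at r)" if "r \<noteq> 0" for r :: real
  proof (cases "r > 0")
    case True
    show ?thesis
      by (rule has_derivative_transform_within_open[of "\<lambda>_. 1" _ _ _ "{0<..}"]) (use True in auto)
  next
    case False
    show ?thesis
      by (rule has_derivative_transform_within_open[of "\<lambda>_. -1" _ _ _ "{..<0}"])
        (use False that in auto)
  qed
  have "((\<lambda>x. sgn (f x)) has_derivative (\<lambda>_. 0)) (at x)" if "x \<in> S" for x
    using has_derivative_compose[of f "f' x" x UNIV sgn "\<lambda>_. 0"] f' sgn assms that by auto
  then show ?thesis unfolding Suc Ck_on.simps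
    by (intro exI[of _ "\<lambda>_ _. 0"] conjI allI ballI Ck_on_const) auto
qed

text \<open>On both half-lines the derivative of \<open>ln \<bar>r\<bar>\<close> is
  \<open>inverse r\<close>; the product and inverse rules give the remaining orders without an
  induction.\<close>

lemma Ck_on_ln_abs:
  fixes f :: "'a::euclidean_space \<Rightarrow> real"
  assumes "\<And>x. x \<in> S \<Longrightarrow> f x \<noteq> 0"
  shows "Ck_on k S f \<Longrightarrow> Ck_on k S (\<lambda>x. ln \<bar>f x\<bar>)"
proof (cases k)
  case 0
  assume "Ck_on k S f"
  then show ?thesis using assms 0 by (auto intro!: continuous_intros)
next
  case (Suc n)
  assume Ck: "Ck_on k S f"
  then obtain f' where f': "\<forall>x\<in>S. (f has_derivative f' x) (at x)" "\<forall>v. Ck_on n S (\<lambda>x. f' x v)"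
    using Suc by auto
  have ln: "((\<lambda>r. ln \<bar>r\<bar>) has_derivative (\<lambda>v. inverse r * v)) (at r)" if "r \<noteq> 0" for r :: real
  proof (cases "r > 0")
    case True
    show ?thesis
      by (rule has_derivative_transform_within_open[of "\<lambda>r. ln r" _ _ _ "{0<..}"])
        (use True in \<open>auto intro!: derivative_eq_intros simp: field_simps\<close>)
  next
    case False
    show ?thesis
      by (rule has_derivative_transform_within_open[of "\<lambda>r. ln (- r)" _ _ _ "{..<0}"])
        (use False that in \<open>auto intro!: derivative_eq_intros simp: field_simps\<close>)
  qed
  have "((\<lambda>x. ln \<bar>f x\<bar>) has_derivative (\<lambda>v. inverse (f x) * f' x v)) (at x)" if "x \<in> S" for x
    using has_derivative_compose[of f "f' x" x UNIV "\<lambda>r. ln \<bar>r\<bar>" "\<lambda>v. inverse (f x) * v"]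
      f' ln assms that by auto
  moreover have "Ck_on n S (\<lambda>x. inverse (f x) * f' x v)" for v
    using Ck f'(2) assms by (intro Ck_on_mult Ck_on_inverse) (auto dest: Ck_on_SucD simp: Suc simp del: Ck_on.simps)
  ultimately show ?thesis unfolding Suc Ck_on.simps
    by (intro exI[of _ "\<lambda>x v. inverse (f x) * f' x v"]) auto
qed

lemma smooth_on_const: "smooth_on S (\<lambda>x. c)"
  by (simp add: smooth_on_def Ck_on_const)

lemma smooth_on_bounded_linear: "bounded_linear f \<Longrightarrow> smooth_on S f"
  by (simp add: smooth_on_def Ck_on_bounded_linear)

lemma smooth_on_linear_compose: "bounded_linear L \<Longrightarrow> smooth_on S f \<Longrightarrow> smooth_on S (\<lambda>x. L (f x))"
  by (simp add: smooth_on_def Ck_on_linear_compose)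

lemma smooth_on_add: "smooth_on S f \<Longrightarrow> smooth_on S g \<Longrightarrow> smooth_on S (\<lambda>x. f x + g x)"
  by (simp add: smooth_on_def Ck_on_add)

lemma smooth_on_scaleR: "smooth_on S f \<Longrightarrow> smooth_on S g \<Longrightarrow> smooth_on S (\<lambda>x. f x *\<^sub>R g x)"
  by (simp add: smooth_on_def Ck_on_scaleR)

lemma smooth_on_mult:
  fixes f g :: "'a::euclidean_space \<Rightarrow> real"
  shows "smooth_on S f \<Longrightarrow> smooth_on S g \<Longrightarrow> smooth_on S (\<lambda>x. f x * g x)"
  by (simp add: smooth_on_def Ck_on_mult)

lemma smooth_on_divide:
  fixes f g :: "'a::euclidean_space \<Rightarrow> real"
  shows "smooth_on S f \<Longrightarrow> smooth_on S g \<Longrightarrow> (\<And>x. x \<in> S \<Longrightarrow> g x \<noteq> 0) \<Longrightarrow> smooth_on S (\<lambda>x. f x / g x)"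
  by (simp add: smooth_on_def Ck_on_mult Ck_on_inverse divide_inverse)

lemma smooth_on_exp:
  fixes f :: "'a::euclidean_space \<Rightarrow> real"
  shows "smooth_on S f \<Longrightarrow> smooth_on S (\<lambda>x. exp (f x))"
  by (simp add: smooth_on_def Ck_on_exp)

lemma smooth_on_sgn:
  fixes f :: "'a::euclidean_space \<Rightarrow> real"
  shows "smooth_on S f \<Longrightarrow> (\<And>x. x \<in> S \<Longrightarrow> f x \<noteq> 0) \<Longrightarrow> smooth_on S (\<lambda>x. sgn (f x))"
  by (simp add: smooth_on_def Ck_on_sgn)

lemma smooth_on_ln_abs:
  fixes f :: "'a::euclidean_space \<Rightarrow> real"
  shows "smooth_on S f \<Longrightarrow> (\<And>x. x \<in> S \<Longrightarrow> f x \<noteq> 0) \<Longrightarrow> smooth_on S (\<lambda>x. ln \<bar>f x\<bar>)"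
  by (simp add: smooth_on_def Ck_on_ln_abs)

lemma smooth_on_continuous_on: "smooth_on S f \<Longrightarrow> continuous_on S f"
  by (auto simp: smooth_on_def intro: Ck_on_continuous_on)

lemma smooth_on_has_derivative:
  "smooth_on S f \<Longrightarrow> x \<in> S \<Longrightarrow> (f has_derivative frechet_derivative f (at x)) (at x)"
  unfolding smooth_on_def
  by (metis Ck_on.simps(2) differentiableI frechet_derivative_works)

lemma smooth_on_Pair: 
  assumes "smooth_on S f" "smooth_on S g"
  shows "smooth_on S (\<lambda>x. (f x, g x))"
proof -
  have "bounded_linear (\<lambda>y. (y, 0))" "bounded_linear (\<lambda>y. (0, y))"
    by (intro bounded_linear_Pair bounded_linear_ident bounded_linear_zero)+
  from smooth_on_add[OF smooth_on_linear_compose[OF this(1) assms(1)] smooth_on_linear_compose[OF this(2) assms(2)]]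
  show ?thesis by simp
qed

subsection \<open>Polynomial functions\<close>

lemma smooth_on_polynomial: "real_polynomial_function f \<Longrightarrow> smooth_on S f"
  by (induction rule: real_polynomial_function.induct)
    (auto intro: smooth_on_bounded_linear smooth_on_const smooth_on_add smooth_on_mult)

text \<open>Because directional derivatives are polynomials in the base point, the determinant that
  tests functional independence is a polynomial, and one nonzero value makes it nonzero on a dense
  set.\<close>

lemma polynomial_directional_derivative:
  assumes "real_polynomial_function f"
  shows "\<exists>f'. (\<forall>x. (f has_derivative f' x) (at x)) \<and> (\<forall>v. real_polynomial_function (\<lambda>x. f' x v))"
  using assms
proof (induction rule: real_polynomial_function.induct)
  case (linear f)
  then show ?case by (intro exI[of _ "\<lambda>x. f"]) (auto intro: bounded_linear_imp_has_derivative)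
next
  case (const c)
  show ?case by (intro exI[of _ "\<lambda>x v. 0"]) auto
next
  case (add f g)
  then obtain f' g' where "\<forall>x. (f has_derivative f' x) (at x)" "\<forall>v. real_polynomial_function (\<lambda>x. f' x v)"
    "\<forall>x. (g has_derivative g' x) (at x)" "\<forall>v. real_polynomial_function (\<lambda>x. g' x v)" by auto
  then show ?case by (intro exI[of _ "\<lambda>x v. f' x v + g' x v"]) (auto intro: has_derivative_add)
next
  case (mult f g)
  then obtain f' g' where "\<forall>x. (f has_derivative f' x) (at x)" "\<forall>v. real_polynomial_function (\<lambda>x. f' x v)"
    "\<forall>x. (g has_derivative g' x) (at x)" "\<forall>v. real_polynomial_function (\<lambda>x. g' x v)" by auto
  with mult.hyps show ?case
    by (intro exI[of _ "\<lambda>x v. f x * g' x v + f' x v * g x"] conjI allI has_derivative_mult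
        real_polynomial_function.intros(3,4)) auto
qed

lemma polynomial_function_affine_line: "polynomial_function (\<lambda>t::real. a + t *\<^sub>R v)"
proof -
  have "bounded_linear (\<lambda>t::real. t *\<^sub>R v)" by (rule bounded_linear_scaleR_left)
  then show ?thesis by (intro polynomial_function_add) (auto intro: polynomial_function_bounded_linear)
qed

text \<open>On the line from a point where \<open>f\<close> does not vanish to a given point, \<open>f\<close> is a nonzero
  polynomial in one variable, so its zeros do not accumulate at the given point.\<close>

lemma polynomial_nonzero_dense:
  fixes f :: "'a::euclidean_space \<Rightarrow> real"
  assumes f: "real_polynomial_function f" and a: "f a \<noteq> 0"
  shows "closure {x. f x \<noteq> 0} = UNIV"
proof -
  have "x \<in> closure {x. f x \<noteq> 0}" for x
  proof -
    let ?l = "\<lambda>t. x + t *\<^sub>R (a - x)"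
    have "real_polynomial_function (f \<circ> ?l)"
      by (intro real_polynomial_function_compose f polynomial_function_affine_line)
    then obtain c n where c: "f \<circ> ?l = (\<lambda>t. \<Sum>i\<le>n. c i * t ^ i)"
      by (auto simp: real_polynomial_function_iff_sum)
    \<comment> \<open>At \<open>t = 1\<close> the line passes through \<open>a\<close>, so the
      coefficients cannot all vanish.\<close>
    have "(\<Sum>i\<le>n. c i * 1 ^ i) \<noteq> 0" using a fun_cong[OF c, of 1] by simp
    then have "\<exists>i\<le>n. c i \<noteq> 0" by (rule contrapos_np) simp
    then obtain i where "i \<le> n" "c i \<noteq> 0" by auto
    then have fin: "finite {t. f (?l t) = 0}"
      using polyfun_roots_finite[of c i n] fun_cong[OF c] by simp
    show ?thesis unfolding closure_approachable
    proof (intro allI impI)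
      fix e :: real assume "e > 0"
      \<comment> \<open>The summand \<open>1\<close> keeps the denominator positive when
        \<open>a = x\<close>.\<close>
      define d where "d = e / (norm (a - x) + 1)"
      have "d > 0" using \<open>e > 0\<close> by (simp add: d_def add_nonneg_pos)
      then obtain t where t: "t \<in> {0<..<d}" "f (?l t) \<noteq> 0"
        using fin finite_subset[OF _ fin, of "{0<..<d}"] infinite_Ioo[of 0 d] by (auto simp del: greaterThanLessThan_iff)
      have "dist (?l t) x = t * norm (a - x)" using t by (simp add: dist_norm)
      also have "\<dots> \<le> d * norm (a - x)" using t by (intro mult_right_mono) auto
      also have "\<dots> < d * (norm (a - x) + 1)" using \<open>d > 0\<close> by simp
      also have "\<dots> = e" unfolding d_def using norm_ge_zero[of "a - x"] by (simp add: add_nonneg_eq_0_iff)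
      finally show "\<exists>y\<in>{x. f x \<noteq> 0}. dist y x < e" using t by blast
    qed
  qed
  then show ?thesis by auto
qed

lemma continuous_on_polynomial:
  fixes f :: "'a::euclidean_space \<Rightarrow> real"
  shows "real_polynomial_function f \<Longrightarrow> continuous_on S f"
  by (rule smooth_on_continuous_on[OF smooth_on_polynomial])

lemma borel_measurable_polynomial:
  fixes f :: "'a::euclidean_space \<Rightarrow> real"
  shows "real_polynomial_function f \<Longrightarrow> f \<in> borel_measurable borel"
  by (intro borel_measurable_continuous_onI continuous_on_polynomial)

lemma open_polynomial_nonzero: 
  fixes f :: "'a::euclidean_space \<Rightarrow> real"
  shows "real_polynomial_function f \<Longrightarrow> open {x. f x \<noteq> 0}"
  by (intro open_Collect_neq continuous_on_polynomial continuous_on_const)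

subsection \<open>Change of variables\<close>

text \<open>The change of variables theorem speaks of absolute integrability, whereas measures are
  nonnegative integrals. For nonnegative integrands the two are matched through their real values
  \<open>b\<close>.\<close>

lemma absolutely_integrable_iff_nn_integral:
  fixes f :: "'a::euclidean_space \<Rightarrow> real"
  assumes f[measurable]: "f \<in> borel_measurable borel" and S[measurable]: "S \<in> sets borel"
    and nn: "\<And>x. x \<in> S \<Longrightarrow> 0 \<le> f x"
  shows "f absolutely_integrable_on S \<and> integral S f = b \<longleftrightarrow>
    0 \<le> b \<and> (\<integral>\<^sup>+x\<in>S. ennreal (f x) \<partial>lborel) = ennreal b" (is "?L \<longleftrightarrow> ?R")
proof
  assume L: ?L
  then have "(f has_integral b) S"
    using set_lebesgue_integral_eq_integral(1) integrable_integral by blast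
  moreover have "0 \<le> b" using L nn integral_nonneg[of f S] set_lebesgue_integral_eq_integral(1) by blast
  ultimately show ?R using nn_integral_has_integral_lebesgue'[of S f b] nn by auto
next
  assume R: ?R
  let ?g = "\<lambda>x. f x * indicator S x"
  have eq: "(\<integral>\<^sup>+x. ennreal (?g x) \<partial>lborel) = ennreal b"
    using R by (simp add: ennreal_mult'' ennreal_indicator)
  have "(?g has_integral b) UNIV"
    using R eq nn by (intro nn_integral_has_integral) (auto simp: indicator_def)
  then have hi: "(f has_integral b) S"
    unfolding has_integral_restrict_UNIV[of S f b, symmetric]
    by (rule has_integral_eq[rotated]) (auto simp: indicator_def)
  then have "f absolutely_integrable_on S"
    using nn by (intro nonnegative_absolutely_integrable_1) auto
  with hi show ?L by auto
qed

text \<open>A Borel function \<open>h\<close> stands in for the Jacobian times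
  \<open>f \<circ> g\<close>, as \<open>g'\<close> comes without any measurability.\<close>

lemma nn_integral_image:
  fixes g :: "real^'n::{finite,wellorder} \<Rightarrow> real^'n::_" and f h :: "real^'n::_ \<Rightarrow> real"
  assumes S: "S \<in> sets borel" and gS: "g ` S \<in> sets borel"
    and der: "\<And>x. x \<in> S \<Longrightarrow> (g has_derivative g' x) (at x within S)"
    and inj: "inj_on g S"
    and f: "f \<in> borel_measurable borel" "\<And>x. 0 \<le> f x"
    and h: "h \<in> borel_measurable borel" "\<And>x. x \<in> S \<Longrightarrow> \<bar>det (matrix (g' x))\<bar> * f (g x) = h x"
  shows "(\<integral>\<^sup>+x\<in>g ` S. ennreal (f x) \<partial>lborel) = (\<integral>\<^sup>+x\<in>S. ennreal (h x) \<partial>lborel)"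
proof -
  let ?F = "\<lambda>x. (\<chi> i. f x) :: real^1"
  have "S \<in> sets lebesgue" using S by simp
  from has_absolute_integral_change_of_variables[OF this der inj, of ?F "\<chi> i. b" for b]
  have A: "(\<lambda>x. \<bar>det (matrix (g' x))\<bar> * f (g x)) absolutely_integrable_on S \<and>
      integral S (\<lambda>x. \<bar>det (matrix (g' x))\<bar> * f (g x)) = b
    \<longleftrightarrow> f absolutely_integrable_on (g ` S) \<and> integral (g ` S) f = b" for b
    by (simp add: absolutely_integrable_on_1_iff integral_on_1_eq vec_eq_iff)
  have "(\<lambda>x. \<bar>det (matrix (g' x))\<bar> * f (g x)) absolutely_integrable_on S \<longleftrightarrow> h absolutely_integrable_on S"
    by (rule set_integrable_cong) (use h in auto)
  moreover have "integral S (\<lambda>x. \<bar>det (matrix (g' x))\<bar> * f (g x)) = integral S h"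
    by (rule integral_cong) (use h in auto)
  ultimately have "h absolutely_integrable_on S \<and> integral S h = b
    \<longleftrightarrow> f absolutely_integrable_on (g ` S) \<and> integral (g ` S) f = b" for b
    using A[of b] by simp
  moreover have "0 \<le> h x" if "x \<in> S" for x using h(2)[OF that] f(2) by (metis abs_ge_zero mult_nonneg_nonneg)
  ultimately have *: "0 \<le> b \<and> (\<integral>\<^sup>+x\<in>S. ennreal (h x) \<partial>lborel) = ennreal b \<longleftrightarrow>
      0 \<le> b \<and> (\<integral>\<^sup>+x\<in>g ` S. ennreal (f x) \<partial>lborel) = ennreal b" for b
    using absolutely_integrable_iff_nn_integral[OF h(1) S, of b]
      absolutely_integrable_iff_nn_integral[OF f(1) gS, of b] f(2) by simp
  \<comment> \<open>If either integral is finite, its real value taken for \<open>b\<close> shows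
    that the other one equals it; otherwise both are infinite.\<close>
  show ?thesis using *[of "enn2real (\<integral>\<^sup>+x\<in>S. ennreal (h x) \<partial>lborel)"]
      *[of "enn2real (\<integral>\<^sup>+x\<in>g ` S. ennreal (f x) \<partial>lborel)"]
    by (cases "(\<integral>\<^sup>+x\<in>S. ennreal (h x) \<partial>lborel)"; cases "(\<integral>\<^sup>+x\<in>g ` S. ennreal (f x) \<partial>lborel)")
      auto
qed

text \<open>Integrate over the first component with the second one fixed, and then apply Tonelli's
  theorem.\<close>

lemma nn_integral_skew_image:
  fixes f :: "real^'n::{finite,wellorder} \<Rightarrow> real^'n::_ \<Rightarrow> real^'n::_"
    and m m' :: "(real^'n::_) \<times> (real^'n::_) \<Rightarrow> real"
  defines "F \<equiv> \<lambda>(x, y). (y, f y x)"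
  assumes A: "A \<in> sets borel" and FA: "F ` A \<in> sets borel" and inj: "inj_on F A"
    and der: "\<And>x y. (x, y) \<in> A \<Longrightarrow> (f y has_derivative f' y x) (at x)"
    and m: "m \<in> borel_measurable borel"
    and m': "m' \<in> borel_measurable borel" "\<And>p. 0 \<le> m' p"
    and det: "\<And>x y. (x, y) \<in> A \<Longrightarrow> \<bar>det (matrix (f' y x))\<bar> * m' (y, f y x) = m (x, y)"
  shows "(\<integral>\<^sup>+p\<in>F ` A. ennreal (m' p) \<partial>lborel) = (\<integral>\<^sup>+p\<in>A. ennreal (m p) \<partial>lborel)"
proof -
  note [measurable] = A FA m m'(1)
  have slice: "{z. (y, z) \<in> F ` A} = f y ` {x. (x, y) \<in> A}" for y
    by (force simp: F_def image_iff)
  have meas_A: "{x. (x, y) \<in> A} \<in> sets borel" for y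
    by measurable
  have meas_FA: "{z. (y, z) \<in> F ` A} \<in> sets borel" for y
    by measurable
  \<comment> \<open>The outer variable is \<open>y\<close> on both sides. It is the first component
    of image points but the second component of points of \<open>A\<close>, whence
    \<open>nn_integral_fst\<close> here and \<open>nn_integral_snd\<close> at the end.\<close>
  have "(\<integral>\<^sup>+p\<in>F ` A. ennreal (m' p) \<partial>lborel)
      = (\<integral>\<^sup>+y. \<integral>\<^sup>+z. ennreal (m' (y, z)) * indicator (F ` A) (y, z) \<partial>lborel \<partial>lborel)"
    by (subst lborel_prod[symmetric], subst lborel.nn_integral_fst[symmetric])
      (simp_all add: lborel_prod)
  also have "\<dots> = (\<integral>\<^sup>+y. \<integral>\<^sup>+x. ennreal (m (x, y)) * indicator A (x, y) \<partial>lborel \<partial>lborel)"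
  proof (rule nn_integral_cong)
    fix y
    let ?S = "{x. (x, y) \<in> A}"
    have "(\<integral>\<^sup>+z. ennreal (m' (y, z)) * indicator (F ` A) (y, z) \<partial>lborel)
        = (\<integral>\<^sup>+z\<in>f y ` ?S. ennreal (m' (y, z)) \<partial>lborel)"
      unfolding slice[symmetric] by (simp add: indicator_def)
    also have "\<dots> = (\<integral>\<^sup>+x\<in>?S. ennreal (m (x, y)) \<partial>lborel)"
    proof (rule nn_integral_image)
      show "?S \<in> sets borel" by (rule meas_A)
      show "f y ` ?S \<in> sets borel" using meas_FA[of y] unfolding slice .
      show "(f y has_derivative f' y x) (at x within ?S)" if "x \<in> ?S" for x
        using der that has_derivative_at_withinI by blast
      show "inj_on (f y) ?S" using inj by (force simp: inj_on_def F_def)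
    qed (use det m'(2) in auto)
    finally show "(\<integral>\<^sup>+z. ennreal (m' (y, z)) * indicator (F ` A) (y, z) \<partial>lborel)
        = (\<integral>\<^sup>+x. ennreal (m (x, y)) * indicator A (x, y) \<partial>lborel)"
      by (simp add: indicator_def)
  qed
  also have "\<dots> = (\<integral>\<^sup>+p\<in>A. ennreal (m p) \<partial>lborel)"
    by (subst lborel_prod[symmetric], subst lborel_pair.nn_integral_snd[symmetric])
      (simp_all add: lborel_prod)
  finally show ?thesis .
qed

subsection \<open>Measures on the orbit space\<close>

lemma borel_set_continuous_on:
  fixes f :: "'a::topological_space \<Rightarrow> 'b::topological_space"
  assumes "continuous_on U f" "U \<in> sets borel" "B \<in> sets borel"
  shows "{p \<in> U. f p \<in> B} \<in> sets borel"
proof -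
  have "f \<in> restrict_space borel U \<rightarrow>\<^sub>M borel"
    by (rule borel_measurable_continuous_on_restrict[OF assms(1)])
  from measurable_sets[OF this assms(3)] have "f -` B \<inter> U \<in> sets (restrict_space borel U)"
    by (simp add: space_restrict_space)
  then have "f -` B \<inter> U \<in> sets borel"
    using assms(2) by (simp add: sets_restrict_space_iff)
  moreover have "f -` B \<inter> U = {p \<in> U. f p \<in> B}" by auto
  ultimately show ?thesis by simp
qed

text \<open>The preimage in \<open>U\<close> of a subset of the quotient is a union of orbits. The piece of it on
  which \<open>\<tau> \<circ> \<psi>\<close> lies in \<open>{0..<1}\<close> is cut along the integer level sets of \<open>\<tau>\<close> and reassembled, by
  integer translations along the orbits, to the piece on which \<open>\<tau>\<close> lies in \<open>{0..<1}\<close>.\<close>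

lemma measure_preserving_on_quotient:
  assumes grp: "one_parameter_group \<Phi>"
    and proj: "quotient_projection \<Phi> U \<pi>"
    and coord: "group_coordinate \<Phi> U \<tau>"
    and \<mu>: "sets \<mu> = sets borel"
    and W: "open W" "W \<subseteq> U" "\<And>t p. p \<in> W \<Longrightarrow> \<Phi> t p \<in> W"
    and \<psi>: "continuous_on W \<psi>" "\<And>p. p \<in> W \<Longrightarrow> \<psi> p \<in> U"
      "\<And>t p. p \<in> W \<Longrightarrow> \<psi> (\<Phi> t p) = \<Phi> t (\<psi> p)"
    and mp: "measure_preserving_on \<mu> W \<psi>" "\<And>t. measure_preserving_on \<mu> U (\<Phi> t)"
    and \<sigma>: "\<sigma> \<in> borel_measurable borel" "\<And>p. p \<in> U \<Longrightarrow> \<sigma> (\<pi> p) \<in> U" "\<And>q. \<sigma> q \<in> U \<Longrightarrow> \<pi> (\<sigma> q) = q"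
    and \<psi>q: "\<And>p. p \<in> W \<Longrightarrow> \<pi> (\<psi> p) = \<psi>q (\<pi> p)"
  shows "measure_preserving_on (quotient_measure \<mu> U \<pi> \<tau>) (\<pi> ` W) \<psi>q"
proof -
  have zero: "\<Phi> 0 p = p" and add: "\<Phi> (s + t) p = \<Phi> s (\<Phi> t p)" for s t p
    using grp unfolding one_parameter_group_def by blast+
  have inv: "\<Phi> (- t) (\<Phi> t p) = p" "\<Phi> t (\<Phi> (- t) p) = p" for t p
    using add[of "- t" t p] add[of t "- t" p] zero by auto
  have U: "open U" "\<And>t p. p \<in> U \<Longrightarrow> \<Phi> t p \<in> U"
    and orbit: "\<And>p q. p \<in> U \<Longrightarrow> q \<in> U \<Longrightarrow> \<pi> p = \<pi> q \<longleftrightarrow> (\<exists>t. q = \<Phi> t p)"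
    using proj by (auto simp: quotient_projection_def)
  have cont_\<pi>: "continuous_on U \<pi>" and cont_\<tau>: "continuous_on U \<tau>"
    using proj coord by (auto simp: quotient_projection_def group_coordinate_def
        intro: smooth_on_continuous_on)
  have \<tau>: "\<tau> (\<Phi> t p) = \<tau> p + t" if "p \<in> U" for t p
    using coord that by (auto simp: group_coordinate_def)
  have U_borel: "U \<in> sets borel" and W_borel: "W \<in> sets borel" using U W by auto
  define V where "V = {p \<in> U. 0 \<le> \<tau> p \<and> \<tau> p < 1}"
  have V: "V \<in> sets borel"
    using borel_set_continuous_on[OF cont_\<tau> U_borel, of "{0..<1}"] by (simp add: V_def)
  have \<pi>_meas: "\<pi> \<in> restrict_space \<mu> V \<rightarrow>\<^sub>M borel"
  proof -
    have "\<pi> \<in> restrict_space borel V \<rightarrow>\<^sub>M borel"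
      by (rule borel_measurable_continuous_on_restrict, rule continuous_on_subset[OF cont_\<pi>])
        (auto simp: V_def)
    then show ?thesis
      using measurable_cong_sets[OF sets_restrict_space_cong[OF \<mu>] refl] by blast
  qed
  have space_\<mu>: "space \<mu> = UNIV" using sets_eq_imp_space_eq[OF \<mu>] by simp
  have \<nu>: "emeasure (quotient_measure \<mu> U \<pi> \<tau>) A = emeasure \<mu> {p \<in> V. \<pi> p \<in> A}"
    if "A \<in> sets borel" for A
  proof -
    have "emeasure (quotient_measure \<mu> U \<pi> \<tau>) A = emeasure (restrict_space \<mu> V) (\<pi> -` A \<inter> V)"
      unfolding quotient_measure_def V_def[symmetric]
      using that \<pi>_meas by (simp add: emeasure_distr space_restrict_space space_\<mu>)
    also have "\<dots> = emeasure \<mu> (\<pi> -` A \<inter> V)"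
      using V \<mu> space_\<mu> by (intro emeasure_restrict_space) auto
    also have "\<pi> -` A \<inter> V = {p \<in> V. \<pi> p \<in> A}" by auto
    finally show ?thesis .
  qed
  have inj_\<psi>: "inj_on \<psi> W" using mp(1) by (simp add: measure_preserving_on_def)
  \<comment> \<open>Image points on one orbit differ by some \<open>\<Phi> t\<close>, which commutes
    with \<open>\<psi>\<close> and so can be pulled back by the injectivity of
    \<open>\<psi>\<close>.\<close>
  have inj: "inj_on \<psi>q (\<pi> ` W)"
  proof (clarsimp simp: inj_on_def)
    fix p p' assume p: "p \<in> W" "p' \<in> W" "\<psi>q (\<pi> p) = \<psi>q (\<pi> p')"
    then have "\<pi> (\<psi> p) = \<pi> (\<psi> p')" using \<psi>q by simp
    then obtain t where "\<psi> p' = \<Phi> t (\<psi> p)" using orbit \<psi>(2) p by blast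
    then have "p' = \<Phi> t p" using \<psi>(3) inj_\<psi> W(3) p by (metis inj_onD)
    then show "\<pi> p = \<pi> p'" using orbit p W by blast
  qed
  have "\<psi>q ` A \<in> sets borel \<and>
      emeasure \<mu> {p \<in> V. \<pi> p \<in> \<psi>q ` A} = emeasure \<mu> {p \<in> V. \<pi> p \<in> A}"
    if A: "A \<in> sets borel" "A \<subseteq> \<pi> ` W" for A
  proof
    define E where "E = {p \<in> U. \<pi> p \<in> A}"
    have E_borel: "E \<in> sets borel"
      unfolding E_def by (rule borel_set_continuous_on[OF cont_\<pi> U_borel A(1)])
    \<comment> \<open>\<open>W\<close> is a union of orbits, so a fibre of \<open>\<pi>\<close> in
      \<open>U\<close> that meets \<open>W\<close> lies in \<open>W\<close>.\<close>
    have EW: "E \<subseteq> W"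
    proof
      fix p assume "p \<in> E"
      then obtain w where "p \<in> U" "w \<in> W" "\<pi> w = \<pi> p" using A(2) by (force simp: E_def)
      then show "p \<in> W" using orbit W by (metis subsetD)
    qed
    have E\<Phi>: "\<Phi> t p \<in> E" if "p \<in> E" for p t
      using that orbit[of p "\<Phi> t p"] U(2)[of p t] by (auto simp: E_def)
    have im: "\<psi> ` E = {p \<in> U. \<pi> p \<in> \<psi>q ` A}"
    proof (intro equalityI subsetI)
      fix p assume "p \<in> \<psi> ` E"
      then show "p \<in> {p \<in> U. \<pi> p \<in> \<psi>q ` A}" using EW \<psi>(2) \<psi>q by (auto simp: E_def)
    next
      fix p assume "p \<in> {p \<in> U. \<pi> p \<in> \<psi>q ` A}"
      then obtain w where w: "p \<in> U" "w \<in> W" "\<pi> w \<in> A" "\<pi> p = \<psi>q (\<pi> w)" using A(2) by fastforce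
      then have "\<pi> (\<psi> w) = \<pi> p" using \<psi>q by simp
      then obtain t where "p = \<Phi> t (\<psi> w)" using orbit \<psi>(2) w by blast
      then have "p = \<psi> (\<Phi> t w)" using \<psi>(3) w by simp
      moreover have "w \<in> E" using w W by (auto simp: E_def)
      ultimately show "p \<in> \<psi> ` E" using E\<Phi> by blast
    qed
    have im_borel: "\<psi> ` E \<in> sets borel"
      using mp(1) E_borel EW \<mu> by (auto simp: measure_preserving_on_def)
    \<comment> \<open>The Borel section \<open>\<sigma>\<close> turns the direct image under
      \<open>\<psi>q\<close> into the preimage of a Borel set; direct images of Borel sets need not
      be Borel.\<close>
    have "\<psi>q ` A = \<sigma> -` (\<psi> ` E)"
    proof (intro equalityI subsetI)
      fix q assume q: "q \<in> \<psi>q ` A"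
      then obtain w where "w \<in> W" "q = \<psi>q (\<pi> w)" using A(2) by auto
      then have "q = \<pi> (\<psi> w)" "\<psi> w \<in> U" using \<psi>q \<psi>(2) by auto
      then have "\<sigma> q \<in> U" "\<pi> (\<sigma> q) = q" using \<sigma>(2,3) by auto
      then show "q \<in> \<sigma> -` (\<psi> ` E)" using q unfolding im by auto
    next
      fix q assume "q \<in> \<sigma> -` (\<psi> ` E)"
      then have "\<sigma> q \<in> U" "\<pi> (\<sigma> q) \<in> \<psi>q ` A" unfolding im by auto
      then show "q \<in> \<psi>q ` A" using \<sigma>(3) by simp
    qed
    then show "\<psi>q ` A \<in> sets borel" using measurable_sets[OF \<sigma>(1) im_borel] by simp
    have cont: "continuous_on W (\<lambda>p. \<tau> (\<psi> p))"
      by (rule continuous_on_compose2[OF cont_\<tau> \<psi>(1)]) (use \<psi>(2) in auto)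
    define T where "T k = {p \<in> E. \<lfloor>\<tau> p\<rfloor> = k \<and> \<tau> (\<psi> p) \<in> {0..<1}}" for k
    define R where "R k = {p \<in> E. \<tau> p \<in> {0..<1} \<and> \<lfloor>\<tau> (\<psi> p)\<rfloor> = - k}" for k
    have borel: "{p \<in> E. \<tau> p \<in> B \<and> \<tau> (\<psi> p) \<in> C} \<in> sets borel"
      if "B \<in> sets borel" "C \<in> sets borel" for B C
    proof -
      have "{p \<in> E. \<tau> p \<in> B \<and> \<tau> (\<psi> p) \<in> C} = E \<inter> {p \<in> U. \<tau> p \<in> B} \<inter> {p \<in> W. \<tau> (\<psi> p) \<in> C}"
        using EW W by auto
      then show ?thesis
        using borel_set_continuous_on[OF cont_\<tau> U_borel that(1)]
          borel_set_continuous_on[OF cont W_borel that(2)] E_borel by auto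
    qed
    have floor: "\<lfloor>x\<rfloor> = k \<longleftrightarrow> x \<in> {of_int k..<of_int k + 1}" for x :: real and k
      by (simp add: floor_eq_iff)
    have T_borel: "T k \<in> sets \<mu>" and R_borel: "R k \<in> sets \<mu>" for k
      unfolding T_def R_def floor \<mu> by (intro borel; simp)+
    have shift: "\<Phi> t p \<in> E" "\<tau> (\<Phi> t p) = \<tau> p + t" "\<tau> (\<psi> (\<Phi> t p)) = \<tau> (\<psi> p) + t"
      if "p \<in> E" for t p
    proof -
      have "p \<in> W" "p \<in> U" using that EW W(2) by blast+
      then show "\<Phi> t p \<in> E" "\<tau> (\<Phi> t p) = \<tau> p + t" "\<tau> (\<psi> (\<Phi> t p)) = \<tau> (\<psi> p) + t"
        using E\<Phi>[OF that] \<tau>[of p t] \<tau>[OF \<psi>(2)[of p], of t] \<psi>(3)[of p t] by simp_all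
    qed
    \<comment> \<open>Translation by \<open>-k\<close> lowers both \<open>\<tau> p\<close> and
      \<open>\<tau> (\<psi> p)\<close> by \<open>k\<close>: the first moves from
      \<open>{k..<k+1}\<close> to \<open>{0..<1}\<close>, the second from \<open>{0..<1}\<close> to
      \<open>{-k..<-k+1}\<close>.\<close>
    have "R k = \<Phi> (- of_int k) ` T k" for k
    proof (intro equalityI subsetI)
      fix p assume p: "p \<in> R k"
      then have "\<Phi> (of_int k) p \<in> T k"
        using shift[of p] unfolding R_def T_def floor by auto
      moreover have "p = \<Phi> (- of_int k) (\<Phi> (of_int k) p)" using inv by simp
      ultimately show "p \<in> \<Phi> (- of_int k) ` T k" by blast
    next
      fix p assume "p \<in> \<Phi> (- of_int k) ` T k"
      then obtain w where "w \<in> T k" "p = \<Phi> (- of_int k) w" by auto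
      then show "p \<in> R k"
        using shift[of w] unfolding R_def T_def floor by auto
    qed
    moreover have "T k \<subseteq> U" for k using EW W by (auto simp: T_def)
    ultimately have TR: "emeasure \<mu> (R k) = emeasure \<mu> (T k)" for k
      using mp(2)[of "- of_int k"] T_borel by (simp add: measure_preserving_on_def)
    have "{p \<in> V. \<pi> p \<in> \<psi>q ` A} = \<psi> ` {p \<in> E. \<tau> p \<in> UNIV \<and> \<tau> (\<psi> p) \<in> {0..<1}}"
    proof -
      have "{p \<in> V. \<pi> p \<in> \<psi>q ` A} = {p \<in> \<psi> ` E. \<tau> p \<in> {0..<1}}"
        unfolding im by (auto simp: V_def)
      then show ?thesis by auto
    qed
    then have "emeasure \<mu> {p \<in> V. \<pi> p \<in> \<psi>q ` A}
        = emeasure \<mu> {p \<in> E. \<tau> p \<in> UNIV \<and> \<tau> (\<psi> p) \<in> {0..<1}}"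
      using mp(1) borel[of UNIV "{0..<1}"] EW \<mu> by (auto simp: measure_preserving_on_def)
    also have "{p \<in> E. \<tau> p \<in> UNIV \<and> \<tau> (\<psi> p) \<in> {0..<1}} = (\<Union>k. T k)"
      by (auto simp: T_def)
    also have "emeasure \<mu> \<dots> = (\<integral>\<^sup>+k. emeasure \<mu> (T k) \<partial>count_space UNIV)"
      using T_borel by (intro emeasure_UN_countable) (auto simp: T_def disjoint_family_on_def)
    also have "\<dots> = (\<integral>\<^sup>+k. emeasure \<mu> (R k) \<partial>count_space UNIV)" using TR by simp
    also have "\<dots> = emeasure \<mu> (\<Union>k. R k)"
      using R_borel by (intro emeasure_UN_countable[symmetric]) (auto simp: R_def disjoint_family_on_def)
    also have "(\<Union>k. R k) = {p \<in> V. \<pi> p \<in> A}"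
    proof (intro equalityI subsetI)
      fix p assume "p \<in> {p \<in> V. \<pi> p \<in> A}"
      then have "p \<in> R (- \<lfloor>\<tau> (\<psi> p)\<rfloor>)" by (simp add: R_def V_def E_def)
      then show "p \<in> (\<Union>k. R k)" by blast
    qed (auto simp: R_def V_def E_def)
    finally show "emeasure \<mu> {p \<in> V. \<pi> p \<in> \<psi>q ` A} = emeasure \<mu> {p \<in> V. \<pi> p \<in> A}" .
  qed
  moreover have "sets (quotient_measure \<mu> U \<pi> \<tau>) = sets borel" by (simp add: quotient_measure_def)
  ultimately show ?thesis unfolding measure_preserving_on_def using inj \<nu> by simp
qed

subsection \<open>The polar map in coordinates\<close>

definition om :: "real^2 \<Rightarrow> real^2 \<Rightarrow> real" where
  "om x y = x $ 1 * y $ 2 - x $ 2 * y $ 1"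

lemma vec2_eq_iff: "x = y \<longleftrightarrow> x $ 1 = y $ 1 \<and> x $ 2 = y $ 2" for x y :: "'a^2"
  by (simp add: vec_eq_iff forall_2)

lemma polynomial_fst_nth: "real_polynomial_function (\<lambda>p::phase. fst p $ i)"
  by (rule real_polynomial_function.intros(1)) (intro bounded_linear_compose[OF bounded_linear_vec_nth] bounded_linear_fst)

lemma polynomial_snd_nth: "real_polynomial_function (\<lambda>p::phase. snd p $ i)"
  by (rule real_polynomial_function.intros(1)) (intro bounded_linear_compose[OF bounded_linear_vec_nth] bounded_linear_snd)

lemmas polynomial_phase = polynomial_fst_nth polynomial_snd_nth

lemma smooth_on_vec2:
  fixes f :: "'a::euclidean_space \<Rightarrow> real^2"
  assumes "\<And>i. smooth_on S (\<lambda>p. f p $ i)"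
  shows "smooth_on S f"
proof -
  have f: "f = (\<lambda>p. (f p $ 1) *\<^sub>R axis 1 1 + (f p $ 2) *\<^sub>R axis 2 1)"
    by (simp add: fun_eq_iff vec2_eq_iff axis_def)
  show ?thesis
    by (subst f) (intro smooth_on_add smooth_on_scaleR smooth_on_const assms)
qed

lemma det_matrix_2: "det (matrix f) = f (axis 1 1) $ 1 * f (axis 2 1) $ 2 - f (axis 2 1) $ 1 * f (axis 1 1) $ 2"
  for f :: "real^2 \<Rightarrow> real^2"
  by (simp add: det_2 matrix_def)

locale quartic =
  fixes c :: "nat \<Rightarrow> real"
begin

text \<open>\<open>c k\<close> is the value of the rescaled form \<open>HH\<close> on basis vectors, \<open>k\<close> of which are the second one.
  The \<open>co i x y\<close> are the entries of the symmetric matrix of \<open>HH x y\<close>, \<open>mv x y\<close> is multiplication by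
  \<open>M (x, y)\<close>, and \<open>den x y = det (1 - M (x, y))\<close>.\<close>

definition co :: "nat \<Rightarrow> real^2 \<Rightarrow> real^2 \<Rightarrow> real" where
  "co i x y = c i * x $ 1 * y $ 1 + c (i + 1) * (x $ 1 * y $ 2 + x $ 2 * y $ 1) + c (i + 2) * x $ 2 * y $ 2"

definition mv :: "real^2 \<Rightarrow> real^2 \<Rightarrow> real^2 \<Rightarrow> real^2" where
  "mv x y u = (co 1 x y * u $ 1 + co 2 x y * u $ 2) *\<^sub>R axis 1 1
    - (co 0 x y * u $ 1 + co 1 x y * u $ 2) *\<^sub>R axis 2 1"

definition den :: "real^2 \<Rightarrow> real^2 \<Rightarrow> real" where
  "den x y = 1 + (co 0 x y * co 2 x y - (co 1 x y)\<^sup>2)"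

definition nxt :: "real^2 \<Rightarrow> real^2 \<Rightarrow> real^2" where
  "nxt x y = (1 / den x y) *\<^sub>R (x + mv x y x)"

definition prv :: "real^2 \<Rightarrow> real^2 \<Rightarrow> real^2" where
  "prv y z = (1 / den y z) *\<^sub>R (z - mv y z z)"

definition step :: "phase \<Rightarrow> phase" where
  "step p = (snd p, nxt (fst p) (snd p))"

definition stepinv :: "phase \<Rightarrow> phase" where
  "stepinv p = (prv (fst p) (snd p), fst p)"

definition reg :: "phase set" where
  "reg = {p. den (fst p) (snd p) \<noteq> 0}"

section \<open>Algebra of the trace-free matrix and the inverse step\<close>

lemma mv_nth: "mv x y u $ 1 = co 1 x y * u $ 1 + co 2 x y * u $ 2"
    "mv x y u $ 2 = - (co 0 x y * u $ 1 + co 1 x y * u $ 2)"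
  by (simp_all add: mv_def axis_def)

lemma co_expand:
  "co 0 x y = c 0 * x $ 1 * y $ 1 + c 1 * (x $ 1 * y $ 2 + x $ 2 * y $ 1) + c 2 * x $ 2 * y $ 2"
  "co 1 x y = c 1 * x $ 1 * y $ 1 + c 2 * (x $ 1 * y $ 2 + x $ 2 * y $ 1) + c 3 * x $ 2 * y $ 2"
  "co 2 x y = c 2 * x $ 1 * y $ 1 + c 3 * (x $ 1 * y $ 2 + x $ 2 * y $ 1) + c 4 * x $ 2 * y $ 2"
  by (simp_all add: co_def eval_nat_numeral)

text \<open>Through the area form \<open>mv x y z\<close> represents the functional
  \<open>HH x y z\<close>, so it inherits the full symmetry. Hence the polar equation can also be
  solved for \<open>x\<close>, with the matrix at \<open>(y, z)\<close>.\<close>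

lemma mv_commute: "mv x y z = mv y z x"
  by (simp add: vec2_eq_iff mv_nth co_expand algebra_simps del: One_nat_def)

lemma linear_mv: "linear (mv x y)"
  by (rule linearI) (simp_all add: vec2_eq_iff mv_nth algebra_simps)

text \<open>Cayley-Hamilton for the trace-free matrix \<open>M\<close>, whose determinant is
  \<open>den x y - 1\<close>. It gives \<open>(1 - M) (1 + M) = den x y\<close>, the source of the
  formulas for \<open>nxt\<close> and \<open>prv\<close>.\<close>

lemma mv_mv: "mv x y (mv x y u) = (1 - den x y) *\<^sub>R u"
  by (simp add: vec2_eq_iff mv_nth den_def algebra_simps power2_eq_square)

lemma mv_linear_simps:
  "mv x y (a + b) = mv x y a + mv x y b" "mv x y (a - b) = mv x y a - mv x y b"
  "mv x y (r *\<^sub>R a) = r *\<^sub>R mv x y a"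
  using linear_mv[of x y] by (simp_all add: linear_add linear_diff linear_scale)

lemma linear_id_minus_mv: "linear (\<lambda>v. v - mv x y v)"
  by (rule linearI) (auto simp: mv_linear_simps algebra_simps)

lemma det_id_minus_mv: "det (matrix (\<lambda>v. v - mv x y v)) = den x y"
  and det_id_plus_mv: "det (matrix (\<lambda>v. v + mv x y v)) = den x y"
  by (simp_all add: det_matrix_2 mv_nth axis_def den_def power2_eq_square algebra_simps)

lemma nxt_iff:
  assumes "den x y \<noteq> 0"
  shows "z - mv x y z = x \<longleftrightarrow> z = nxt x y"
proof
  assume z: "z - mv x y z = x"
  then have "mv x y x = mv x y z - (1 - den x y) *\<^sub>R z"
    using mv_mv[of x y z] mv_linear_simps(2)[of x y z "mv x y z"] by simp
  moreover have "mv x y z = z - x" using z by (metis add_diff_cancel_left' diff_add_cancel)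
  ultimately have "x + mv x y x = den x y *\<^sub>R z"
    by (simp add: algebra_simps)
  then show "z = nxt x y" using assms by (simp add: nxt_def)
next
  assume z: "z = nxt x y"
  have "den x y *\<^sub>R (z - mv x y z) = den x y *\<^sub>R x"
    using assms unfolding z nxt_def by (simp add: mv_linear_simps mv_mv algebra_simps)
  then show "z - mv x y z = x" using assms by simp
qed

lemma prv_iff:
  assumes "den y z \<noteq> 0"
  shows "x + mv y z x = z \<longleftrightarrow> x = prv y z"
proof
  assume "x + mv y z x = z"
  then have "mv y z z = mv y z x + (1 - den y z) *\<^sub>R x"
    using mv_mv[of y z x] mv_linear_simps(1)[of y z x "mv y z x"] by simp
  moreover have "mv y z x = z - x" using \<open>x + mv y z x = z\<close> by (metis add_diff_cancel_left')
  ultimately have "z - mv y z z = den y z *\<^sub>R x"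
    by (simp add: algebra_simps)
  then show "x = prv y z" using assms by (simp add: prv_def)
next
  assume x: "x = prv y z"
  have "den y z *\<^sub>R (x + mv y z x) = den y z *\<^sub>R z"
    using assms unfolding x prv_def by (simp add: mv_linear_simps mv_mv algebra_simps)
  then show "x + mv y z x = z" using assms by simp
qed

text \<open>Both sides are the polar equation for \<open>(x, y, z)\<close>, solved once for its last
  and once for its first argument.\<close>

lemma nxt_prv:
  assumes "den x y \<noteq> 0" "den y z \<noteq> 0"
  shows "z = nxt x y \<longleftrightarrow> x = prv y z"
  using nxt_iff[OF assms(1), of z] prv_iff[OF assms(2), of x] mv_commute[of x y z]
  by (metis add_diff_cancel_right' diff_add_cancel)

lemma stepinv_step: "p \<in> reg \<Longrightarrow> step p \<in> reg \<Longrightarrow> stepinv (step p) = p"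
  using nxt_prv[of "fst p" "snd p" "nxt (fst p) (snd p)"]
  by (simp add: reg_def step_def stepinv_def prod_eq_iff)

lemma step_stepinv: "q \<in> reg \<Longrightarrow> stepinv q \<in> reg \<Longrightarrow> step (stepinv q) = q"
  using nxt_prv[of "prv (fst q) (snd q)" "fst q" "snd q"]
  by (simp add: reg_def step_def stepinv_def prod_eq_iff)

text \<open>A trace-free \<open>M\<close> is skew for the area form,
  \<open>om (M z) y = - om z (M y)\<close>, and \<open>prv y z\<close> and \<open>nxt y z\<close>
  carry the same denominator.\<close>

lemma om_prv: "om (prv y z) y = om z (nxt y z)"
  by (simp add: om_def prv_def nxt_def mv_nth algebra_simps add_divide_distrib diff_divide_distrib)

lemma om_periodic:
  assumes "den x y \<noteq> 0" "den y (nxt x y) \<noteq> 0"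
  shows "om (nxt x y) (nxt y (nxt x y)) = om x y"
  using om_prv[of y "nxt x y"] nxt_prv[OF assms] by simp

section \<open>Polynomial structure and smoothness of the step\<close>

lemma polynomial_co:
  assumes "\<And>i. real_polynomial_function (\<lambda>p::phase. f p $ i)" "\<And>i. real_polynomial_function (\<lambda>p. g p $ i)"
  shows "real_polynomial_function (\<lambda>p. co j (f p) (g p))"
  unfolding co_def by (intro real_polynomial_function.intros(2-) assms)

lemma polynomial_mv:
  assumes "\<And>i. real_polynomial_function (\<lambda>p::phase. f p $ i)" "\<And>i. real_polynomial_function (\<lambda>p. g p $ i)"
    "\<And>i. real_polynomial_function (\<lambda>p. k p $ i)"
  shows "real_polynomial_function (\<lambda>p. mv (f p) (g p) (k p) $ i)"
proof -
  have "i = 1 \<or> i = 2" by (rule exhaust_2)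
  then show ?thesis
    by (auto simp: mv_nth intro!: real_polynomial_function.intros(3-) real_polynomial_function_minus polynomial_co assms
        simp del: minus_add_distrib)
qed

lemma polynomial_den:
  assumes "\<And>i. real_polynomial_function (\<lambda>p::phase. f p $ i)" "\<And>i. real_polynomial_function (\<lambda>p. g p $ i)"
  shows "real_polynomial_function (\<lambda>p. den (f p) (g p))"
  unfolding den_def power2_eq_square
  by (intro real_polynomial_function.intros(2-) real_polynomial_function_diff polynomial_co assms)

lemma polynomial_den_phase: "real_polynomial_function (\<lambda>p. den (fst p) (snd p))"
  by (intro polynomial_den polynomial_phase)

lemma open_reg: "open reg"
  unfolding reg_def by (intro open_polynomial_nonzero polynomial_den_phase)

lemma polynomial_nxt_num: "real_polynomial_function (\<lambda>p. (fst p + mv (fst p) (snd p) (fst p)) $ i)"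
  unfolding vector_add_component
  by (intro real_polynomial_function.intros(3) polynomial_mv polynomial_phase)

lemma smooth_on_nxt: "smooth_on reg (\<lambda>p. nxt (fst p) (snd p))"
  unfolding nxt_def
  by (intro smooth_on_scaleR smooth_on_divide smooth_on_const smooth_on_vec2 smooth_on_polynomial
      polynomial_den_phase polynomial_nxt_num) (simp add: reg_def)

lemma polynomial_prv_num: "real_polynomial_function (\<lambda>p. (snd p - mv (fst p) (snd p) (snd p)) $ i)"
  unfolding vector_minus_component
  by (intro real_polynomial_function_diff polynomial_mv polynomial_phase)

lemma smooth_on_prv: "smooth_on reg (\<lambda>p. prv (fst p) (snd p))"
  unfolding prv_def
  by (intro smooth_on_scaleR smooth_on_divide smooth_on_const smooth_on_vec2 smooth_on_polynomial
      polynomial_den_phase polynomial_prv_num) (simp add: reg_def)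

lemma continuous_on_step: "continuous_on reg step"
  unfolding step_def using smooth_on_continuous_on[OF smooth_on_nxt] by (intro continuous_intros)

lemma continuous_on_stepinv: "continuous_on reg stepinv"
  unfolding stepinv_def using smooth_on_continuous_on[OF smooth_on_prv] by (intro continuous_intros)

section \<open>The domain of the second iterate and its density\<close>

definition reg2 :: "phase set" where
  "reg2 = second_iterate_dom reg step"

lemma reg2_iff: "p \<in> reg2 \<longleftrightarrow> p \<in> reg \<and> step p \<in> reg"
  by (simp add: reg2_def second_iterate_dom_def)

lemma inj_on_step: "inj_on step reg2"
  by (metis stepinv_step reg2_iff inj_onI)

text \<open>As \<open>stepinv\<close> is continuous on \<open>reg\<close>, writing images as
  preimages makes images of open sets open and images of Borel sets Borel.\<close>

lemma step_image: "X \<subseteq> reg2 \<Longrightarrow> step ` X = {q \<in> reg. stepinv q \<in> X}"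
  using stepinv_step step_stepinv by (force simp: reg2_iff subset_eq image_iff)

lemma open_reg2: "open reg2"
proof -
  have "reg2 = reg \<inter> step -` reg" by (auto simp: reg2_iff)
  then show ?thesis using continuous_open_preimage[OF continuous_on_step open_reg open_reg] by simp
qed

text \<open>The denominator at the image point, multiplied by the square of the denominator at the
  point itself, is a polynomial with constant term \<open>1\<close>.\<close>

lemma dense_reg2: "closure reg2 = UNIV"
proof -
  let ?w = "\<lambda>p::phase. fst p + mv (fst p) (snd p) (fst p)"
  let ?N = "\<lambda>p. den (fst p) (snd p) * ((den (fst p) (snd p))\<^sup>2 + (co 0 (snd p) (?w p) * co 2 (snd p) (?w p)
    - (co 1 (snd p) (?w p))\<^sup>2))"
  have "real_polynomial_function ?N"
    unfolding power2_eq_square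
    by (intro real_polynomial_function.intros(2-) real_polynomial_function_diff polynomial_co
        polynomial_den_phase polynomial_nxt_num polynomial_phase)
  moreover have "?N 0 \<noteq> 0" by (simp add: den_def co_def)
  ultimately have "closure {p. ?N p \<noteq> 0} = UNIV" by (rule polynomial_nonzero_dense)
  moreover have "{p. ?N p \<noteq> 0} \<subseteq> reg2"
  proof
    fix p assume "p \<in> {p. ?N p \<noteq> 0}"
    moreover define x y where "x = fst p" and "y = snd p"
    ultimately have d: "den x y \<noteq> 0"
      "(den x y)\<^sup>2 + (co 0 y (x + mv x y x) * co 2 y (x + mv x y x) - (co 1 y (x + mv x y x))\<^sup>2) \<noteq> 0"
      by auto
    have co: "co i y (nxt x y) = co i y (x + mv x y x) / den x y" for i
      by (simp add: co_def nxt_def add_divide_distrib algebra_simps)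
    have "(den x y)\<^sup>2 * den y (nxt x y) =
        (den x y)\<^sup>2 + (co 0 y (x + mv x y x) * co 2 y (x + mv x y x) - (co 1 y (x + mv x y x))\<^sup>2)"
      unfolding den_def[of y] co using d(1) by (simp add: field_simps power2_eq_square)
    with d have "den y (nxt x y) \<noteq> 0" by auto
    with d(1) show "p \<in> reg2" by (simp add: reg2_iff reg_def step_def x_def y_def)
  qed
  ultimately show ?thesis using closure_mono[of "{p. ?N p \<noteq> 0}" reg2] by auto
qed

text \<open>Density pulls back because \<open>step\<close> is an open map on \<open>reg2\<close>: if
  the preimage of \<open>V\<close> missed a nonempty open set, the image of that set would be
  nonempty, open and disjoint from \<open>V\<close>.\<close>

lemma dense_step_preimage:
  assumes "open V" "closure V = UNIV"
  shows "open {p \<in> reg2. step p \<in> V}" "closure {p \<in> reg2. step p \<in> V} = UNIV"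
proof -
  have "{p \<in> reg2. step p \<in> V} = reg2 \<inter> step -` V" by auto
  moreover have "continuous_on reg2 step"
    by (rule continuous_on_subset[OF continuous_on_step]) (auto simp: reg2_iff)
  ultimately show "open {p \<in> reg2. step p \<in> V}"
    using continuous_open_preimage open_reg2 assms(1) by metis
  show "closure {p \<in> reg2. step p \<in> V} = UNIV"
  proof (rule ccontr)
    assume "closure {p \<in> reg2. step p \<in> V} \<noteq> UNIV"
    define X where "X = reg2 - closure {p \<in> reg2. step p \<in> V}"
    have X: "open X" "X \<subseteq> reg2" unfolding X_def using open_reg2 by auto
    have "X \<noteq> {}"
    proof
      assume "X = {}"
      then have "reg2 \<subseteq> closure {p \<in> reg2. step p \<in> V}" by (auto simp: X_def)
      then have "closure reg2 \<subseteq> closure {p \<in> reg2. step p \<in> V}" by (simp add: closure_minimal)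
      with dense_reg2 show False using \<open>closure _ \<noteq> UNIV\<close> by auto
    qed
    have "step ` X = reg \<inter> stepinv -` X" using step_image[OF X(2)] by auto
    then have "open (step ` X)"
      using continuous_open_preimage[OF continuous_on_stepinv open_reg X(1)] by simp
    moreover have "step ` X \<noteq> {}" using \<open>X \<noteq> {}\<close> by simp
    ultimately have "step ` X \<inter> V \<noteq> {}"
      using assms(2) open_Int_closure_eq_empty[of "step ` X" V] by auto
    then obtain p where "p \<in> X" "step p \<in> V" by auto
    then show False using closure_subset[of "{p \<in> reg2. step p \<in> V}"] X by (auto simp: X_def)
  qed
qed

subsection \<open>The invariant measure\<close>

definition m :: "phase \<Rightarrow> real" where
  "m p = 1 / \<bar>den (fst p) (snd p)\<bar>"

lemma m_measurable: "m \<in> borel_measurable borel"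
  unfolding m_def using borel_measurable_polynomial[OF polynomial_den_phase] by measurable

lemma m_nonneg: "0 \<le> m p"
  by (simp add: m_def)

text \<open>With the second argument fixed, \<open>x \<mapsto> z = nxt x y\<close> is implicitly defined by
  \<open>z - mv x y z = x\<close>, and \<open>mv\<close> is symmetric in its three arguments, so the derivative \<open>N\<close>
  satisfies \<open>N v - mv x y (N v) = v + mv y z v\<close>.\<close>

lemma nxt_derivative:
  assumes "den x y \<noteq> 0"
  shows "\<exists>N. ((\<lambda>x. nxt x y) has_derivative N) (at x) \<and> den x y * det (matrix N) = den y (nxt x y)"
proof -
  have "(x, y) \<in> reg" using assms by (simp add: reg_def)
  define G where "G = frechet_derivative (\<lambda>p. nxt (fst p) (snd p)) (at (x, y))"
  have G: "((\<lambda>p. nxt (fst p) (snd p)) has_derivative G) (at (x, y))"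
    unfolding G_def by (rule smooth_on_has_derivative[OF smooth_on_nxt \<open>(x, y) \<in> reg\<close>])
  define N where "N = (\<lambda>v. G (v, 0))"
  have "((\<lambda>x. (x, y)) has_derivative (\<lambda>v. (v, 0))) (at x)"
    by (auto intro!: derivative_eq_intros)
  from has_derivative_compose[OF this G]
  have N: "((\<lambda>x. nxt x y) has_derivative N) (at x)" by (simp add: N_def)
  have bl: "bounded_bilinear (\<lambda>a b. mv a y b)"
    by (intro bilinear_conv_bounded_bilinear[THEN iffD1])
      (auto simp: bilinear_def linear_iff vec2_eq_iff mv_nth co_def algebra_simps)
  have lhs: "((\<lambda>x. nxt x y - mv x y (nxt x y)) has_derivative
      (\<lambda>v. N v - (mv x y (N v) + mv v y (nxt x y)))) (at x)"
    by (intro has_derivative_diff N bounded_bilinear.FDERIV[OF bl] has_derivative_ident)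
  have "open {x. den x y \<noteq> 0}"
  proof -
    have "{x. den x y \<noteq> 0} = (\<lambda>x. (x, y)) -` reg" by (auto simp: reg_def)
    then show ?thesis using open_vimage[OF open_reg, of "\<lambda>x. (x, y)"] by (simp add: continuous_on_Pair)
  qed
  then have "((\<lambda>x. x) has_derivative (\<lambda>v. N v - (mv x y (N v) + mv v y (nxt x y)))) (at x)"
    by (rule has_derivative_transform_within_open[OF lhs]) (use assms nxt_iff in auto)
  then have "(\<lambda>v. N v - (mv x y (N v) + mv v y (nxt x y))) = (\<lambda>v. v)"
    using has_derivative_unique has_derivative_ident by blast
  then have "(\<lambda>v. v - mv x y v) \<circ> N = (\<lambda>v. v + mv y (nxt x y) v)"
    using mv_commute[of _ y "nxt x y"] by (auto simp: fun_eq_iff algebra_simps) 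
  \<comment> \<open>Since \<open>M\<close> has trace zero, \<open>1 - M\<close> and
    \<open>1 + M\<close> both have determinant \<open>1 + det M\<close>, which is \<open>den\<close>
    at the respective pair.\<close>
  then have "det (matrix (\<lambda>v. v - mv x y v)) * det (matrix N) = det (matrix (\<lambda>v. v + mv y (nxt x y) v))"
    using matrix_compose[of N "\<lambda>v. v - mv x y v"] has_derivative_linear[OF N] linear_id_minus_mv
    by (simp add: det_mul)
  then show ?thesis using N by (auto simp: det_id_minus_mv det_id_plus_mv)
qed

lemma step_image_borel:
  assumes "A \<in> sets borel" "A \<subseteq> reg2"
  shows "step ` A \<in> sets borel"
  unfolding step_image[OF assms(2)]
  by (rule borel_set_continuous_on[OF continuous_on_stepinv _ assms(1)]) (simp add: open_reg)

text \<open>With \<open>z = nxt x y\<close>, the Jacobian \<open>den y z / den x y\<close> of one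
  step cancels the change of density up to sign, so a single step already preserves the
  measure.\<close>

lemma nn_integral_step_image:
  assumes A: "A \<in> sets borel" "A \<subseteq> reg2"
  shows "(\<integral>\<^sup>+p\<in>step ` A. ennreal (m p) \<partial>lborel) = (\<integral>\<^sup>+p\<in>A. ennreal (m p) \<partial>lborel)"
proof -
  have step: "step = (\<lambda>(x, y). (y, nxt x y))" by (simp add: step_def fun_eq_iff)
  define N where "N y x = (SOME N. ((\<lambda>x. nxt x y) has_derivative N) (at x)
    \<and> den x y * det (matrix N) = den y (nxt x y))" for x y
  have N: "((\<lambda>x. nxt x y) has_derivative N y x) (at x)" "den x y * det (matrix (N y x)) = den y (nxt x y)"
    if "(x, y) \<in> A" for x y
    using someI_ex[OF nxt_derivative[of x y]] that A(2) by (auto simp: N_def reg2_iff reg_def)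
  show ?thesis
    unfolding step
  proof (rule nn_integral_skew_image)
    show "\<bar>det (matrix (N y x))\<bar> * m (y, nxt x y) = m (x, y)" if "(x, y) \<in> A" for x y
    proof -
      have "den x y \<noteq> 0" "den y (nxt x y) \<noteq> 0" using that A(2) by (auto simp: reg2_iff reg_def step_def)
      then show ?thesis unfolding m_def using N(2)[OF that, symmetric] by (simp add: abs_mult)
    qed
    show "(\<lambda>(x, y). (y, nxt x y)) ` A \<in> sets borel" "inj_on (\<lambda>(x, y). (y, nxt x y)) A"
      using step_image_borel[OF A] inj_on_subset[OF inj_on_step A(2)] unfolding step by auto
  qed (use A N m_measurable m_nonneg in auto)
qed

end

section \<open>Coordinates in three-space, directional derivatives and scaled swaps\<close>

lemma vec3_eq_iff: "x = y \<longleftrightarrow> x $ 1 = y $ 1 \<and> x $ 2 = y $ 2 \<and> x $ 3 = y $ 3" for x y :: "'a^3"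
  by (simp add: vec_eq_iff forall_3)

lemma axis_3_nth: "(axis i a :: real^3) $ j = (if i = j then a else 0)"
  by (simp add: axis_def)

lemma smooth_on_fst_nth: "smooth_on S (\<lambda>p::phase. fst p $ i)"
  and smooth_on_snd_nth: "smooth_on S (\<lambda>p::phase. snd p $ i)"
  by (intro smooth_on_polynomial polynomial_phase)+

lemma has_derivative_direction:
  fixes f :: "'a::real_normed_vector \<Rightarrow> real"
  assumes f': "(f has_derivative f') (at p)" and "\<And>t. f (p + t *\<^sub>R w) = g t"
    and g: "(g has_real_derivative d) (at 0)"
  shows "f' w = d"
proof -
  have "((\<lambda>t. p + t *\<^sub>R w) has_derivative (\<lambda>t. t *\<^sub>R w)) (at 0)"
    by (auto intro!: derivative_eq_intros)
  then have "((\<lambda>t. f (p + t *\<^sub>R w)) has_derivative (\<lambda>t. f' (t *\<^sub>R w))) (at 0)"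
    using has_derivative_compose[of "\<lambda>t. p + t *\<^sub>R w" _ 0 UNIV f f'] f' by simp
  moreover have "(g has_derivative (\<lambda>t. d * t)) (at 0)" using g by (simp add: has_field_derivative_def)
  ultimately have "(\<lambda>t. f' (t *\<^sub>R w)) = (\<lambda>t. d * t)"
    unfolding assms(2) by (rule has_derivative_unique)
  from fun_cong[OF this, of 1] show ?thesis by simp
qed

text \<open>\<open>nn_integral_skew_image\<close> treats maps that move the second component to the
  front, so a scaling is combined with a swap. The factor \<open>s\<^sup>2\<close> is the Jacobian
  of the scaling in the plane.\<close>

lemma nn_integral_swap_scale_image:
  fixes A :: "phase set" and k k' :: "phase \<Rightarrow> real"
  assumes "A \<in> sets borel" "s \<noteq> 0" "k \<in> borel_measurable borel" "k' \<in> borel_measurable borel"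
    and "\<And>p. 0 \<le> k' p" "\<And>x y. s\<^sup>2 * k' (y, s *\<^sub>R x) = k (x, y)"
  shows "(\<lambda>(x, y). (y, s *\<^sub>R x)) ` A \<in> sets borel"
    and "(\<integral>\<^sup>+p\<in>(\<lambda>(x, y). (y, s *\<^sub>R x)) ` A. ennreal (k' p) \<partial>lborel) = (\<integral>\<^sup>+p\<in>A. ennreal (k p) \<partial>lborel)"
proof -
  have "(\<lambda>(x, y). (y, s *\<^sub>R x)) ` A = {q \<in> UNIV. ((1 / s) *\<^sub>R snd q, fst q) \<in> A}"
    using assms(2) by (force simp: image_iff)
  moreover have "{q \<in> UNIV. ((1 / s) *\<^sub>R snd q, fst q) \<in> A} \<in> sets borel"
    by (rule borel_set_continuous_on[OF _ _ assms(1)]) (auto intro!: continuous_intros)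
  ultimately show im: "(\<lambda>(x, y). (y, s *\<^sub>R x)) ` A \<in> sets borel" by simp
  show "(\<integral>\<^sup>+p\<in>(\<lambda>(x, y). (y, s *\<^sub>R x)) ` A. ennreal (k' p) \<partial>lborel) = (\<integral>\<^sup>+p\<in>A. ennreal (k p) \<partial>lborel)"
  proof (rule nn_integral_skew_image[where f' = "\<lambda>y x v. s *\<^sub>R v"])
    show "inj_on (\<lambda>(x, y). (y, s *\<^sub>R x)) A" using assms(2) by (auto simp: inj_on_def)
    show "((*\<^sub>R) s has_derivative (*\<^sub>R) s) (at x)" for x :: "real^2"
      by (auto intro!: derivative_eq_intros)
    show "\<bar>det (matrix ((*\<^sub>R) s :: real^2 \<Rightarrow> real^2))\<bar> * k' (y, s *\<^sub>R x) = k (x, y)" for x y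
      using assms(6) by (simp add: det_matrix_2 axis_def power2_eq_square)
  qed (use assms im in auto)
qed

context quartic
begin

subsection \<open>The symmetry group and its quotient\<close>

definition grp :: "real \<Rightarrow> phase \<Rightarrow> phase" where
  "grp t p = (exp t *\<^sub>R fst p, exp (- t) *\<^sub>R snd p)"

lemma one_parameter_group_grp: "one_parameter_group grp"
  unfolding one_parameter_group_def
proof (intro conjI allI)
  have "smooth_on UNIV (\<lambda>q::real \<times> phase. grp (fst q) (snd q))"
    unfolding grp_def
    by (intro smooth_on_Pair smooth_on_scaleR smooth_on_exp smooth_on_bounded_linear
        bounded_linear_minus bounded_linear_fst bounded_linear_snd
        bounded_linear_compose[OF bounded_linear_fst] bounded_linear_compose[OF bounded_linear_snd])
  then show "smooth_on UNIV (\<lambda>(t, p). grp t p)" by (simp add: case_prod_unfold)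
qed (simp_all add: grp_def exp_add exp_diff exp_minus divide_inverse mult.commute)

lemma co_scale: "co i (exp t *\<^sub>R x) (exp (- t) *\<^sub>R y) = co i x y"
proof -
  have "co i (exp t *\<^sub>R x) (exp (- t) *\<^sub>R y) = exp t * exp (- t) * co i x y"
    by (simp add: co_def algebra_simps)
  then show ?thesis by (simp flip: exp_add)
qed

lemma den_scale: "den (exp t *\<^sub>R x) (exp (- t) *\<^sub>R y) = den x y"
  by (simp add: den_def co_scale)

lemma grp_reg: "grp t p \<in> reg \<longleftrightarrow> p \<in> reg"
  by (simp add: reg_def grp_def den_scale)

lemma nxt_scale: "nxt (exp t *\<^sub>R x) (exp (- t) *\<^sub>R y) = exp t *\<^sub>R nxt x y"
proof -
  have "mv (exp t *\<^sub>R x) (exp (- t) *\<^sub>R y) u = mv x y u" for u by (simp add: mv_def co_scale)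
  then show ?thesis
    by (simp add: nxt_def den_scale mv_linear_simps scaleR_add_right mult.commute)
qed

text \<open>The two components, scaled by inverse factors, trade places in a step; so one step
  reverses the group parameter and two steps commute with the group.\<close>

lemma step_grp: "step (grp t p) = grp (- t) (step p)"
  by (simp add: step_def grp_def nxt_scale)

lemma grp_reg2: "grp t p \<in> reg2 \<longleftrightarrow> p \<in> reg2"
  by (simp add: reg2_iff grp_reg step_grp)

text \<open>The sign in the last component of \<open>proj\<close> separates the orbits of \<open>(x, y)\<close> and
  \<open>(- x, - y)\<close>, on which all products \<open>x $ i * y $ j\<close> agree.\<close>

definition chart :: "phase set" where
  "chart = {p. den (fst p) (snd p) * (fst p $ 1 * snd p $ 1) \<noteq> 0}"

definition proj :: "phase \<Rightarrow> real^3" where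
  "proj p = (fst p $ 2 / fst p $ 1) *\<^sub>R axis 1 1 + (snd p $ 2 / snd p $ 1) *\<^sub>R axis 2 1
    + (sgn (fst p $ 1) * exp (fst p $ 1 * snd p $ 1)) *\<^sub>R axis 3 1"

definition coord :: "phase \<Rightarrow> real" where
  "coord p = ln \<bar>fst p $ 1\<bar>"

text \<open>The point of the orbit whose first coordinate is \<open>1\<close> or \<open>-1\<close>,
  where \<open>coord\<close> vanishes. The sign of \<open>q $ 3\<close> is the sign of that
  coordinate, and \<open>ln \<bar>q $ 3\<bar>\<close> is the product of the first coordinates of the
  two components.\<close>

definition sect :: "real^3 \<Rightarrow> phase" where
  "sect q = (sgn (q $ 3) *\<^sub>R (axis 1 1 + q $ 1 *\<^sub>R axis 2 1),
    (sgn (q $ 3) * ln \<bar>q $ 3\<bar>) *\<^sub>R (axis 1 1 + q $ 2 *\<^sub>R axis 2 1))"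

lemma chart_iff: "p \<in> chart \<longleftrightarrow> p \<in> reg \<and> fst p $ 1 \<noteq> 0 \<and> snd p $ 1 \<noteq> 0"
  by (auto simp: chart_def reg_def)

lemma polynomial_chart: "real_polynomial_function (\<lambda>p. den (fst p) (snd p) * (fst p $ 1 * snd p $ 1))"
  by (intro real_polynomial_function.intros(2-) polynomial_den_phase polynomial_phase)

lemma open_chart: "open chart"
  unfolding chart_def by (intro open_polynomial_nonzero polynomial_chart)

lemma dense_chart: "closure chart = UNIV"
proof -
  let ?e = "\<lambda>t::real. (t *\<^sub>R axis 1 1, t *\<^sub>R axis 1 1) :: phase"
  have co: "co i (fst (?e t)) (snd (?e t)) = t\<^sup>2 * c i" for i t
    by (simp add: co_def axis_def power2_eq_square)
  have den: "den (fst (?e t)) (snd (?e t)) = 1 + t^4 * (c 0 * c 2 - (c 1)\<^sup>2)" for t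
    unfolding den_def co by (simp add: algebra_simps power2_eq_square power4_eq_xxxx)
  define K where "K = c 0 * c 2 - (c 1)\<^sup>2"
  \<comment> \<open>The value \<open>t = 1\<close> fails only for \<open>K = -1\<close>, and then
    \<open>t = 2\<close> gives \<open>-15\<close>.\<close>
  have "\<exists>t. t \<noteq> 0 \<and> 1 + t^4 * K \<noteq> 0"
  proof (cases "1 + K = 0")
    case True
    then have "2 \<noteq> (0::real) \<and> 1 + 2^4 * K \<noteq> 0" by auto
    then show ?thesis by blast
  next
    case False
    then show ?thesis by (intro exI[of _ 1]) simp
  qed
  then obtain t where "t \<noteq> 0" "1 + t^4 * K \<noteq> 0" by blast
  then have "den (fst (?e t)) (snd (?e t)) * (fst (?e t) $ 1 * snd (?e t) $ 1) \<noteq> 0"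
    using den[of t] by (simp add: K_def axis_def)
  then show ?thesis unfolding chart_def by (rule polynomial_nonzero_dense[OF polynomial_chart])
qed

lemma grp_chart: "grp t p \<in> chart \<longleftrightarrow> p \<in> chart"
  using grp_reg[of t p] by (simp add: chart_iff) (simp add: grp_def)

lemma proj_nth:
  "proj p $ 1 = fst p $ 2 / fst p $ 1" "proj p $ 2 = snd p $ 2 / snd p $ 1"
  "proj p $ 3 = sgn (fst p $ 1) * exp (fst p $ 1 * snd p $ 1)"
  by (simp_all add: proj_def axis_3_nth)

lemma sect_nth: "fst (sect q) $ 1 = sgn (q $ 3)" "fst (sect q) $ 2 = sgn (q $ 3) * q $ 1"
  "snd (sect q) $ 1 = sgn (q $ 3) * ln \<bar>q $ 3\<bar>" "snd (sect q) $ 2 = sgn (q $ 3) * ln \<bar>q $ 3\<bar> * q $ 2"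
  by (simp_all add: sect_def axis_def)

lemma proj_grp: "proj (grp t p) = proj p"
proof -
  have "exp t * a * (exp (- t) * b) = a * b" for a b :: real
    by (simp add: exp_minus)
  then show ?thesis by (simp add: vec3_eq_iff proj_nth grp_def sgn_mult)
qed

lemma sect_proj: "p \<in> chart \<Longrightarrow> sect (proj p) = grp (- coord p) p"
  by (auto simp: chart_iff prod_eq_iff vec2_eq_iff sect_nth proj_nth grp_def coord_def sgn_mult abs_mult
      exp_minus sgn_if field_simps)

lemma proj_sect: "sect q \<in> chart \<Longrightarrow> proj (sect q) = q"
  by (auto simp: chart_iff vec3_eq_iff sect_nth proj_nth sgn_mult sgn_if split: if_splits)

lemma sect_proj_chart: "p \<in> chart \<Longrightarrow> sect (proj p) \<in> chart"
  by (simp add: sect_proj grp_chart)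

lemma coord_grp: "p \<in> chart \<Longrightarrow> coord (grp t p) = coord p + t"
  by (simp add: coord_def grp_def chart_iff abs_mult ln_mult)

lemma grp_add: "grp s (grp t p) = grp (s + t) p"
  using one_parameter_group_grp by (simp only: one_parameter_group_def)

lemma grp_0: "grp 0 p = p"
  by (simp add: grp_def)

lemma proj_eq_iff:
  assumes "p \<in> chart" "q \<in> chart"
  shows "proj p = proj q \<longleftrightarrow> (\<exists>t. q = grp t p)"
proof
  assume "proj p = proj q"
  then have "grp (- coord p) p = grp (- coord q) q" using assms sect_proj by metis
  then have "grp (coord q) (grp (- coord p) p) = q" by (simp add: grp_add grp_0)
  then show "\<exists>t. q = grp t p" unfolding grp_add by metis
qed (auto simp: proj_grp)

lemma smooth_on_proj: "smooth_on chart proj"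
  unfolding proj_def
  by (intro smooth_on_add smooth_on_scaleR smooth_on_divide smooth_on_mult smooth_on_sgn smooth_on_exp
      smooth_on_const smooth_on_fst_nth smooth_on_snd_nth) (auto simp: chart_iff)

lemma smooth_on_coord: "smooth_on chart coord"
  unfolding coord_def by (intro smooth_on_ln_abs smooth_on_fst_nth) (auto simp: chart_iff)

lemma smooth_on_sect: "smooth_on {q. q $ 3 \<noteq> 0} sect"
  unfolding sect_def
  by (intro smooth_on_Pair smooth_on_add smooth_on_scaleR smooth_on_mult smooth_on_sgn smooth_on_ln_abs
      smooth_on_const smooth_on_bounded_linear bounded_linear_vec_nth) auto

lemma sect_measurable: "sect \<in> borel_measurable borel"
proof -
  have "open {q::real^3. q $ 3 \<noteq> 0}"
    by (intro open_Collect_neq continuous_intros)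
  then have *: "{p \<in> {q. q $ 3 \<noteq> 0}. sect p \<in> B} \<in> sets borel" if "B \<in> sets borel" for B
    using that by (intro borel_set_continuous_on smooth_on_continuous_on[OF smooth_on_sect]) auto
  have 0: "{q::real^3. q $ 3 = 0} \<in> sets borel"
    by (intro borel_closed closed_Collect_eq continuous_intros)
  show ?thesis
  proof (rule measurableI)
    fix B :: "phase set" assume B: "B \<in> sets borel"
    \<comment> \<open>On the plane \<open>q $ 3 = 0\<close> the section is constantly
      \<open>0\<close>, because \<open>sgn 0 = 0\<close>.\<close>
    have "sect -` B \<inter> space borel = {p \<in> {q. q $ 3 \<noteq> 0}. sect p \<in> B} \<union> (if 0 \<in> B then {q. q $ 3 = 0} else {})"
      by (auto simp: sect_def zero_prod_def)
    then show "sect -` B \<inter> space borel \<in> sets borel" using *[OF B] 0 by auto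
  qed simp
qed

text \<open>The map \<open>q \<mapsto> grp (coord p) (sect q)\<close> is a local right inverse of \<open>proj\<close> through \<open>p\<close>.\<close>

lemma surj_proj_derivative:
  assumes p: "p \<in> chart"
  shows "surj (frechet_derivative proj (at p))"
proof -
  let ?q = "proj p" and ?s = "\<lambda>q. grp (coord p) (sect q)"
  have q: "?q \<in> {q. q $ 3 \<noteq> 0}" using p by (auto simp: proj_nth chart_iff sgn_if)
  have op: "open {q::real^3. q $ 3 \<noteq> 0}" by (intro open_Collect_neq continuous_intros)
  have sp: "?s ?q = p" using p by (simp add: sect_proj grp_add grp_0)
  have D: "(proj has_derivative frechet_derivative proj (at p)) (at p)"
    by (rule smooth_on_has_derivative[OF smooth_on_proj p])
  have "(sect has_derivative frechet_derivative sect (at ?q)) (at ?q)"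
    by (rule smooth_on_has_derivative[OF smooth_on_sect q])
  then have S: "(?s has_derivative (\<lambda>v. grp (coord p) (frechet_derivative sect (at ?q) v))) (at ?q)"
    unfolding grp_def by (auto intro!: derivative_eq_intros)
  have "((\<lambda>q. proj (?s q)) has_derivative
      (\<lambda>v. frechet_derivative proj (at p) (grp (coord p) (frechet_derivative sect (at ?q) v)))) (at ?q)"
    using has_derivative_compose[OF S, of proj] D unfolding sp by blast
  moreover have "open ({q. q $ 3 \<noteq> 0} \<inter> sect -` chart)"
    by (intro continuous_open_preimage smooth_on_continuous_on[OF smooth_on_sect] op open_chart)
  moreover have "?q \<in> {q. q $ 3 \<noteq> 0} \<inter> sect -` chart" using q sect_proj_chart[OF p] by simp
  moreover have "proj (?s q) = q" if "q \<in> {q. q $ 3 \<noteq> 0} \<inter> sect -` chart" for q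
    using that by (simp add: proj_grp proj_sect)
  ultimately have "((\<lambda>q. q) has_derivative
      (\<lambda>v. frechet_derivative proj (at p) (grp (coord p) (frechet_derivative sect (at ?q) v)))) (at ?q)"
    by (rule has_derivative_transform_within_open)
  then have "(\<lambda>v. frechet_derivative proj (at p) (grp (coord p) (frechet_derivative sect (at ?q) v))) = (\<lambda>v. v)"
    using has_derivative_unique has_derivative_ident by blast
  then show ?thesis by (intro surjI) (rule fun_cong)
qed

lemma quotient_projection_proj: "quotient_projection grp chart proj"
  unfolding quotient_projection_def
  using open_chart dense_chart smooth_on_proj surj_proj_derivative proj_eq_iff grp_chart by blast

lemma group_coordinate_coord: "group_coordinate grp chart coord"
  unfolding group_coordinate_def using smooth_on_coord coord_grp by blast

lemma emeasure_density_m: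
  assumes "X \<in> sets borel" "X \<subseteq> chart"
  shows "emeasure (measure_with_density chart m) X = (\<integral>\<^sup>+p\<in>X. ennreal (m p) \<partial>lborel)"
proof -
  have [measurable]: "chart \<in> sets borel" "m \<in> borel_measurable borel"
    using open_chart m_measurable by auto
  have "emeasure (measure_with_density chart m) X
      = (\<integral>\<^sup>+p. ennreal (m p) * indicator chart p * indicator X p \<partial>lborel)"
    unfolding measure_with_density_def using assms(1) by (intro emeasure_density) simp_all
  also have "\<dots> = (\<integral>\<^sup>+p\<in>X. ennreal (m p) \<partial>lborel)"
    using assms(2) by (intro nn_integral_cong) (auto simp: indicator_def)
  finally show ?thesis .
qed

lemma sets_density_m: "sets (measure_with_density chart m) = sets borel"
  by (simp add: measure_with_density_def)

text \<open>The action is the composition of two maps of the form \<open>(x, y) \<mapsto> (y, s *\<^sub>R x)\<close>.\<close>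

lemma measure_preserving_grp: "measure_preserving_on (measure_with_density chart m) chart (grp t)"
  unfolding measure_preserving_on_def sets_density_m
proof (intro conjI ballI impI)
  show "inj_on (grp t) chart"
    by (auto simp: inj_on_def grp_def prod_eq_iff)
  fix A assume A: "A \<in> sets borel" "A \<subseteq> chart"
  let ?S = "\<lambda>s. \<lambda>(x, y). (y, s *\<^sub>R x) :: phase"
  \<comment> \<open>The density carried from \<open>m\<close> by the first map, with scale
    \<open>exp t\<close>. The second map, with scale \<open>exp (- t)\<close>, carries it back to
    \<open>m\<close>, since \<open>m\<close> is constant on orbits.\<close>
  let ?k = "\<lambda>p. (exp (- t))\<^sup>2 * m (exp (- t) *\<^sub>R snd p, fst p)"
  have k: "?k \<in> borel_measurable borel"
  proof -
    have "(\<lambda>p::phase. (exp (- t) *\<^sub>R snd p, fst p)) \<in> borel_measurable borel"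
      by (intro borel_measurable_continuous_onI continuous_intros)
    from measurable_compose[OF this m_measurable] show ?thesis
      by (intro borel_measurable_times borel_measurable_const)
  qed
  have e: "exp t * exp (- t) = (1::real)" by (simp flip: exp_add)
  have m_grp: "m (exp t *\<^sub>R x, exp (- t) *\<^sub>R y) = m (x, y)" for x y
    by (simp add: m_def den_scale)
  have 1: "(exp t)\<^sup>2 * ?k (y, exp t *\<^sub>R x) = m (x, y)" for x y
  proof -
    have "(exp t)\<^sup>2 * (exp (- t))\<^sup>2 = (1::real)" using e by (simp flip: power_mult_distrib)
    then show ?thesis using e by (simp add: mult.assoc[symmetric]) (simp add: mult.commute)
  qed
  have 2: "(exp (- t))\<^sup>2 * m (y, exp (- t) *\<^sub>R x) = ?k (x, y)" for x y
    using m_grp[of "exp (- t) *\<^sub>R y" x] e by (simp add: mult.commute)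
  note A1 = nn_integral_swap_scale_image[OF A(1) _ m_measurable k _ 1]
  have borel1: "?S (exp t) ` A \<in> sets borel" by (rule A1(1)) (auto simp: m_nonneg)
  have int1: "(\<integral>\<^sup>+p\<in>?S (exp t) ` A. ennreal (?k p) \<partial>lborel) = (\<integral>\<^sup>+p\<in>A. ennreal (m p) \<partial>lborel)"
    by (rule A1(2)) (auto simp: m_nonneg)
  note A2 = nn_integral_swap_scale_image[OF borel1 _ k m_measurable _ 2]
  have im: "grp t ` A = ?S (exp (- t)) ` ?S (exp t) ` A"
    by (auto simp: grp_def image_image image_iff case_prod_unfold)
  show borel: "grp t ` A \<in> sets borel" unfolding im by (rule A2(1)) (auto simp: m_nonneg)
  have "(\<integral>\<^sup>+p\<in>grp t ` A. ennreal (m p) \<partial>lborel) = (\<integral>\<^sup>+p\<in>A. ennreal (m p) \<partial>lborel)"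
    unfolding im int1[symmetric] by (rule A2(2)) (auto simp: m_nonneg)
  moreover have "grp t ` A \<subseteq> chart" using A(2) grp_chart by auto
  ultimately show "emeasure (measure_with_density chart m) (grp t ` A) = emeasure (measure_with_density chart m) A"
    using emeasure_density_m A borel by simp
qed

subsection \<open>The second iterate\<close>

definition iter2 :: "phase \<Rightarrow> phase" where
  "iter2 = step \<circ> step"

definition iter2_dom :: "phase set" where
  "iter2_dom = dom_within chart reg2 iter2"

lemma iter2_dom_iff: "p \<in> iter2_dom \<longleftrightarrow> p \<in> chart \<and> p \<in> reg2 \<and> iter2 p \<in> chart"
  by (auto simp: iter2_dom_def dom_within_def)

text \<open>Membership of \<open>iter2 p\<close> in \<open>chart\<close> makes a third step regular.
  This allows \<open>stepinv\<close> to be applied twice and \<open>int2\<close>, which looks one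
  step ahead, to be compared at \<open>p\<close> and \<open>iter2 p\<close>.\<close>

lemma iter2_domD:
  assumes "p \<in> iter2_dom"
  shows "p \<in> reg2" "step p \<in> reg2"
  using assms by (auto simp: iter2_dom_iff reg2_iff iter2_def chart_iff)

lemma iter2_grp: "iter2 (grp t p) = grp t (iter2 p)"
  by (simp add: iter2_def step_grp)

lemma iter2_dom_grp: "p \<in> iter2_dom \<Longrightarrow> grp t p \<in> iter2_dom"
  by (simp add: iter2_dom_iff grp_chart grp_reg2 iter2_grp)

lemma continuous_on_iter2: "continuous_on iter2_dom iter2"
  unfolding iter2_def o_def
  by (rule continuous_on_compose2[OF continuous_on_step continuous_on_subset[OF continuous_on_step]])
    (use iter2_domD in \<open>auto simp: reg2_iff\<close>)

lemma open_dense_iter2_dom: "open iter2_dom" "closure iter2_dom = UNIV"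
proof -
  let ?X = "{p \<in> reg2. step p \<in> chart}"
  let ?Y = "{p \<in> reg2. step p \<in> ?X}"
  have X: "open ?X" "closure ?X = UNIV" using dense_step_preimage[OF open_chart dense_chart] .
  have Y: "open ?Y" "closure ?Y = UNIV" using dense_step_preimage[OF X] .
  have eq: "iter2_dom = chart \<inter> ?Y"
    using iter2_domD by (auto simp: iter2_dom_iff iter2_def)
  then show "open iter2_dom" using open_chart Y by auto
  have "chart \<subseteq> closure iter2_dom"
    using open_Int_closure_subset[OF open_chart, of ?Y] Y(2) unfolding eq by auto
  then have "closure chart \<subseteq> closure iter2_dom" by (simp add: closure_minimal)
  then show "closure iter2_dom = UNIV" using dense_chart by auto
qed

lemma measure_preserving_iter2: "measure_preserving_on (measure_with_density chart m) iter2_dom iter2"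
  unfolding measure_preserving_on_def sets_density_m
proof (intro conjI ballI impI)
  show "inj_on iter2 iter2_dom"
    unfolding iter2_def
    by (rule comp_inj_on) (use iter2_domD in \<open>auto intro: inj_on_subset[OF inj_on_step]\<close>)
  fix A assume A: "A \<in> sets borel" "A \<subseteq> iter2_dom"
  have sub: "A \<subseteq> reg2" "step ` A \<subseteq> reg2" "A \<subseteq> chart" "iter2 ` A \<subseteq> chart"
    using A(2) iter2_domD by (auto simp: iter2_dom_iff)
  have im: "iter2 ` A = step ` step ` A" by (simp add: iter2_def image_comp)
  have borel: "step ` A \<in> sets borel" by (rule step_image_borel[OF A(1) sub(1)])
  show borel2: "iter2 ` A \<in> sets borel" unfolding im by (rule step_image_borel[OF borel sub(2)])
  have "(\<integral>\<^sup>+p\<in>iter2 ` A. ennreal (m p) \<partial>lborel) = (\<integral>\<^sup>+p\<in>A. ennreal (m p) \<partial>lborel)"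
    unfolding im nn_integral_step_image[OF borel sub(2)] by (rule nn_integral_step_image[OF A(1) sub(1)])
  then show "emeasure (measure_with_density chart m) (iter2 ` A) = emeasure (measure_with_density chart m) A"
    using emeasure_density_m A(1) borel2 sub by simp
qed

definition quot_map :: "real^3 \<Rightarrow> real^3" where
  "quot_map q = proj (iter2 (sect q))"

text \<open>The section point differs from \<open>p\<close> by a group element, which commutes with
  \<open>iter2\<close> and is forgotten by \<open>proj\<close>.\<close>

lemma proj_iter2: "p \<in> chart \<Longrightarrow> proj (iter2 p) = quot_map (proj p)"
  by (simp add: quot_map_def sect_proj iter2_grp proj_grp)

lemma measure_preserving_quot_map:
  "measure_preserving_on (quotient_measure (measure_with_density chart m) chart proj coord)
    (proj ` iter2_dom) quot_map"
  by (rule measure_preserving_on_quotient[OF one_parameter_group_grp quotient_projection_proj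
        group_coordinate_coord sets_density_m _ _ _ continuous_on_iter2 _ _ measure_preserving_iter2
        measure_preserving_grp sect_measurable])
    (auto simp: open_dense_iter2_dom iter2_dom_grp iter2_grp sect_proj_chart proj_sect proj_iter2 iter2_dom_iff grp_chart grp_reg2)

lemma linear_reconstruction_iter2: "linear_reconstruction chart proj coord iter2_dom iter2 quot_map"
  unfolding linear_reconstruction_def
proof (intro exI[of _ 1] allI impI)
  fix I and q :: "int \<Rightarrow> real^3"
  \<comment> \<open>The increment of \<open>coord\<close> under \<open>iter2\<close> is the same
    along a whole group orbit, so it may be read off at the section point over
    \<open>q n\<close>.\<close>
  let ?b = "\<lambda>n. coord (iter2 (sect (q n))) - coord (sect (q n))"
  have "coord (p (n + 1)) = 1 * coord (p n) + ?b n"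
    if p: "orbit_of I iter2_dom iter2 p \<and> (\<forall>n\<in>I. p n \<in> chart \<and> proj (p n) = q n)" and n: "n \<in> I" "n + 1 \<in> I"
    for p n
  proof -
    have pn: "p n \<in> iter2_dom" "p (n + 1) = iter2 (p n)" "proj (p n) = q n"
      using p n by (auto simp: orbit_of_def)
    then have "p n \<in> chart" "iter2 (p n) \<in> chart" by (auto simp: iter2_dom_iff)
    then show ?thesis
      unfolding pn(3)[symmetric] pn(2) by (simp add: sect_proj iter2_grp coord_grp)
  qed
  then show "\<exists>b. \<forall>p. orbit_of I iter2_dom iter2 p \<and> (\<forall>n\<in>I. p n \<in> chart \<and> proj (p n) = q n) \<longrightarrow>
      (\<forall>n. n \<in> I \<and> n + 1 \<in> I \<longrightarrow> coord (p (n + 1)) = 1 * coord (p n) + b n)"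
    by (intro exI[of _ ?b]) blast
qed

subsection \<open>The integrals\<close>

definition int1 :: "phase \<Rightarrow> real" where
  "int1 p = om (fst p) (snd p)"

definition int2 :: "phase \<Rightarrow> real" where
  "int2 p = int1 (step p)"

definition num :: "phase \<Rightarrow> real" where
  "num p = om (snd p) (fst p + mv (fst p) (snd p) (fst p))"

lemma int2_eq: "int2 p = num p / den (fst p) (snd p)"
  by (simp add: int2_def int1_def num_def step_def nxt_def om_def diff_divide_distrib)

lemma polynomial_int1: "real_polynomial_function int1"
  unfolding int1_def om_def
  by (intro real_polynomial_function_diff real_polynomial_function.intros(4) polynomial_phase)

lemma polynomial_num: "real_polynomial_function num"
  unfolding num_def om_def
  by (intro real_polynomial_function_diff real_polynomial_function.intros(4) polynomial_phase polynomial_nxt_num)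

lemma smooth_on_int2: "smooth_on chart int2"
  unfolding int2_eq
  by (intro smooth_on_divide smooth_on_polynomial polynomial_num polynomial_den_phase)
    (auto simp: chart_iff reg_def)

lemma int1_iter2: "p \<in> reg \<Longrightarrow> step p \<in> reg \<Longrightarrow> int1 (iter2 p) = int1 p"
  using om_periodic[of "fst p" "snd p"] by (simp add: int1_def iter2_def step_def reg_def)

lemma int1_grp: "int1 (grp t p) = int1 p"
proof -
  have "int1 (grp t p) = exp t * exp (- t) * int1 p"
    by (simp add: int1_def om_def grp_def algebra_simps)
  then show ?thesis by (simp flip: exp_add)
qed

lemma int2_iter2: "step p \<in> reg \<Longrightarrow> step (step p) \<in> reg \<Longrightarrow> int2 (iter2 p) = int2 p"
  using int1_iter2[of "step p"] by (simp add: int2_def iter2_def)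

lemma int2_grp: "int2 (grp t p) = int2 p"
  by (simp add: int2_def step_grp int1_grp)

text \<open>A group-invariant \<open>J\<close> agrees at \<open>p\<close> with its value at the
  section point of the orbit, so \<open>J \<circ> sect\<close> serves as the integral of the
  quotient map.\<close>

lemma invariant_integralI:
  assumes "smooth_on chart J" and iter: "\<And>p. p \<in> iter2_dom \<Longrightarrow> J (iter2 p) = J p"
    and grp: "\<And>t p. J (grp t p) = J p"
  shows "invariant_integral grp chart proj iter2_dom iter2 quot_map J"
  unfolding invariant_integral_def
proof (intro conjI exI[of _ "\<lambda>q. J (sect q)"] ballI allI)
  show sp: "J p = J (sect (proj p))" if "p \<in> chart" for p
    using that by (simp add: sect_proj grp)
  fix q assume "q \<in> proj ` iter2_dom"
  then obtain p where p: "p \<in> iter2_dom" "q = proj p" by auto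
  then have "p \<in> chart" "iter2 p \<in> chart" by (auto simp: iter2_dom_iff)
  then show "J (sect (quot_map q)) = J (sect q)"
    using p iter sp proj_iter2 by metis
qed (use assms in auto)

text \<open>On the diagonal, \<open>int1\<close> vanishes and \<open>num\<close> is the negative of this quartic form.\<close>

definition diag_form :: "real^2 \<Rightarrow> real" where
  "diag_form x = co 0 x x * (x $ 1)\<^sup>2 + 2 * co 1 x x * x $ 1 * x $ 2 + co 2 x x * (x $ 2)\<^sup>2"

lemma num_diag: "num (x, x) = - diag_form x"
  by (simp add: num_def om_def mv_nth diag_form_def power2_eq_square algebra_simps)

text \<open>The determinant of the differentials on two fixed vectors, cleared of denominators, is a
  polynomial. At \<open>(x, x)\<close> it is computed from Euler's relation for the direction \<open>(x, x)\<close>, in which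
  \<open>int1\<close> is stationary.\<close>

lemma functionally_independent_int:
  assumes x: "diag_form x \<noteq> 0"
  shows "functionally_independent_on chart int1 int2"
proof -
  let ?P = "\<lambda>p. den (fst p) (snd p)"
  obtain I' where I': "\<And>p. (int1 has_derivative I' p) (at p)" "\<And>v. real_polynomial_function (\<lambda>p. I' p v)"
    using polynomial_directional_derivative[OF polynomial_int1] by blast
  obtain N' where N': "\<And>p. (num has_derivative N' p) (at p)" "\<And>v. real_polynomial_function (\<lambda>p. N' p v)"
    using polynomial_directional_derivative[OF polynomial_num] by blast
  obtain P' where P': "\<And>p. (?P has_derivative P' p) (at p)" "\<And>v. real_polynomial_function (\<lambda>p. P' p v)"
    using polynomial_directional_derivative[OF polynomial_den_phase] by blast
  define v where "v = (x, x)"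
  \<comment> \<open>\<open>u\<close> is \<open>x\<close> turned by a right angle, so
    \<open>om u x\<close> is minus the squared length of \<open>x\<close>; \<open>w\<close> leaves
    the diagonal by moving the first component only.\<close>
  define u :: "real^2" where "u = (- x $ 2) *\<^sub>R axis 1 1 + (x $ 1) *\<^sub>R axis 2 1"
  define w where "w = (u, 0 :: real^2)"
  \<comment> \<open>Numerator of the derivative of \<open>int2 = num / den\<close> by the quotient
    rule.\<close>
  define J where "J p a = N' p a * ?P p - num p * P' p a" for p a
  define D where "D p = I' p v * J p w - I' p w * J p v" for p
  have poly: "real_polynomial_function D"
    unfolding D_def J_def
    by (intro real_polynomial_function_diff real_polynomial_function.intros(4) I' N' P' polynomial_num
        polynomial_den_phase)
  have ray: "v + t *\<^sub>R v = ((1 + t) *\<^sub>R x, (1 + t) *\<^sub>R x)" for t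
    by (simp add: v_def algebra_simps)
  have co: "co i (s *\<^sub>R x) (s *\<^sub>R y) = s\<^sup>2 * co i x y" for i s y
    by (simp add: co_def power2_eq_square algebra_simps)
  have den_ray: "den (s *\<^sub>R x) (s *\<^sub>R x) = 1 + s ^ 4 * (den x x - 1)" for s
    by (simp add: den_def co power2_eq_square power4_eq_xxxx algebra_simps)
  have "I' v v = 0"
    by (rule has_derivative_direction[OF I'(1), of _ _ "\<lambda>_. 0"]) (simp_all add: ray int1_def om_def)
  moreover have "N' v v = 4 * num v"
  proof (rule has_derivative_direction[OF N'(1)])
    have "diag_form (s *\<^sub>R x) = s ^ 4 * diag_form x" for s
      by (simp add: diag_form_def co power2_eq_square power4_eq_xxxx algebra_simps)
    then show "num (v + t *\<^sub>R v) = (1 + t) ^ 4 * num v" for t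
      unfolding ray by (simp add: v_def num_diag)
    show "((\<lambda>t. (1 + t) ^ 4 * num v) has_real_derivative 4 * num v) (at 0)"
      by (auto intro!: derivative_eq_intros)
  qed
  moreover have "P' v v = 4 * (?P v - 1)"
  proof (rule has_derivative_direction[OF P'(1)])
    show "?P (v + t *\<^sub>R v) = 1 + (1 + t) ^ 4 * (?P v - 1)" for t
      unfolding ray by (simp add: v_def den_ray)
    show "((\<lambda>t. 1 + (1 + t) ^ 4 * (?P v - 1)) has_real_derivative 4 * (?P v - 1)) (at 0)"
      by (auto intro!: derivative_eq_intros)
  qed
  moreover have "I' v w = om u x"
  proof (rule has_derivative_direction[OF I'(1)])
    show "int1 (v + t *\<^sub>R w) = t * om u x" for t
      by (simp add: int1_def v_def w_def om_def algebra_simps)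
    show "((\<lambda>t. t * om u x) has_real_derivative om u x) (at 0)"
      by (auto intro!: derivative_eq_intros)
  qed
  \<comment> \<open>The terms with \<open>den\<close> cancel:
    \<open>4 * num v * ?P v - num v * 4 * (?P v - 1) = 4 * num v\<close>.\<close>
  ultimately have "D v = - 4 * om u x * num v"
    by (simp only: D_def J_def) (simp add: algebra_simps)
  moreover have "om u x \<noteq> 0"
  proof
    assume "om u x = 0"
    moreover have "om u x = - ((x $ 1)\<^sup>2 + (x $ 2)\<^sup>2)"
      by (simp add: om_def u_def axis_def power2_eq_square)
    ultimately have "(x $ 1)\<^sup>2 + (x $ 2)\<^sup>2 = 0" by linarith
    then have "x = 0" unfolding sum_power2_eq_zero_iff by (simp add: vec2_eq_iff)
    then show False using x by (simp add: diag_form_def)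
  qed
  moreover have "num v \<noteq> 0" using x by (simp add: v_def num_diag)
  ultimately have "D v \<noteq> 0" by simp
  from polynomial_nonzero_dense[OF poly this] have dense: "closure {p. D p \<noteq> 0} = UNIV" .
  have "chart \<subseteq> closure (chart \<inter> {p. D p \<noteq> 0})"
    using open_Int_closure_subset[OF open_chart, of "{p. D p \<noteq> 0}"] dense by simp
  also have "\<dots> \<subseteq> closure {p \<in> chart. \<forall>a b. (\<forall>v. a * frechet_derivative int1 (at p) v
      + b * frechet_derivative int2 (at p) v = 0) \<longrightarrow> a = 0 \<and> b = 0}"
  proof (rule closure_mono, clarify)
    fix p a b assume p: "p \<in> chart" "D p \<noteq> 0"
    have P: "?P p \<noteq> 0" using p(1) by (simp add: chart_iff reg_def)
    have d1: "frechet_derivative int1 (at p) = I' p"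
      using frechet_derivative_at[OF I'(1)] by simp
    have "(int2 has_derivative (\<lambda>a. J p a / (?P p)\<^sup>2)) (at p)"
      unfolding int2_eq[abs_def]
      using has_derivative_divide[OF N'(1) P'(1) P]
      by (rule has_derivative_eq_rhs) (use P in \<open>simp add: fun_eq_iff J_def field_simps power2_eq_square\<close>)
    then have d2: "frechet_derivative int2 (at p) = (\<lambda>a. J p a / (?P p)\<^sup>2)"
      using frechet_derivative_at by metis
    assume "\<forall>v. a * frechet_derivative int1 (at p) v + b * frechet_derivative int2 (at p) v = 0"
    then have lin: "a * I' p z + b / (?P p)\<^sup>2 * J p z = 0" for z
      unfolding d1 d2 by (metis times_divide_eq_left times_divide_eq_right)
    define b' where "b' = b / (?P p)\<^sup>2"
    \<comment> \<open>Cramer's rule for the two equations given by the directions \<open>v\<close>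
      and \<open>w\<close>.\<close>
    have "a * D p = (a * I' p v + b' * J p v) * J p w - (a * I' p w + b' * J p w) * J p v"
      "b' * D p = (a * I' p w + b' * J p w) * I' p v - (a * I' p v + b' * J p v) * I' p w"
      by (simp_all add: D_def algebra_simps)
    then have "a * D p = 0" "b' * D p = 0" using lin unfolding b'_def by simp_all
    then show "a = 0 \<and> b = 0" using p(2) P by (simp add: b'_def)
  qed
  finally show ?thesis unfolding functionally_independent_on_def .
qed

section \<open>Assembly of complete integrability for the step map\<close>

lemma smooth_on_m: "smooth_on chart m"
proof -
  have "smooth_on chart (\<lambda>p. sgn (den (fst p) (snd p)) / den (fst p) (snd p))"
    by (intro smooth_on_divide smooth_on_sgn smooth_on_polynomial polynomial_den_phase)
      (auto simp: chart_iff reg_def)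
  moreover have "(\<lambda>p. sgn (den (fst p) (snd p)) / den (fst p) (snd p)) = m"
    by (auto simp: m_def fun_eq_iff sgn_if)
  ultimately show ?thesis by simp
qed

text \<open>The polar map is a definite description with unspecified values off its domain, so
  agreement with \<open>step\<close> is asked on \<open>reg\<close> only; the conditions on the
  second iterate see it only on \<open>reg2\<close>.\<close>

lemma completely_integrable_step:
  assumes "diag_form x \<noteq> 0" and \<phi>: "\<And>p. p \<in> reg \<Longrightarrow> \<phi> p = step p"
  shows "completely_integrable reg \<phi>"
proof -
  have reg2: "second_iterate_dom reg \<phi> = reg2"
    using \<phi> by (auto simp: reg2_iff second_iterate_dom_def)
  have iter: "(\<phi> \<circ> \<phi>) p = iter2 p" if "p \<in> reg2" for p
    using \<phi> that by (simp add: iter2_def reg2_iff)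
  have W: "dom_within chart reg2 (\<phi> \<circ> \<phi>) = iter2_dom"
    using iter by (auto simp: dom_within_def iter2_dom_iff)
  have iterW: "(\<phi> \<circ> \<phi>) p = iter2 p" if "p \<in> iter2_dom" for p
    using iter iter2_domD that by blast
  have mp: "measure_preserving_on (measure_with_density chart m) iter2_dom (\<phi> \<circ> \<phi>)"
  proof -
    have "(\<phi> \<circ> \<phi>) ` A = iter2 ` A" if "A \<subseteq> iter2_dom" for A
      using iterW that by (intro image_cong) auto
    moreover have "inj_on (\<phi> \<circ> \<phi>) iter2_dom = inj_on iter2 iter2_dom"
      using iterW by (intro inj_on_cong) auto
    ultimately show ?thesis
      using measure_preserving_iter2 unfolding measure_preserving_on_def by auto
  qed
  have int: "invariant_integral grp chart proj iter2_dom (\<phi> \<circ> \<phi>) quot_map J"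
    if "invariant_integral grp chart proj iter2_dom iter2 quot_map J" for J
    using that iterW unfolding invariant_integral_def by simp
  have orbit: "orbit_of I iter2_dom (\<phi> \<circ> \<phi>) p = orbit_of I iter2_dom iter2 p" for I p
  proof -
    have "p n \<in> iter2_dom \<and> p (n + 1) = (\<phi> \<circ> \<phi>) (p n) \<longleftrightarrow> p n \<in> iter2_dom \<and> p (n + 1) = iter2 (p n)" for n
      using iterW[of "p n"] by auto
    then show ?thesis unfolding orbit_of_def by simp
  qed
  have rec: "linear_reconstruction chart proj coord iter2_dom (\<phi> \<circ> \<phi>) quot_map"
    using linear_reconstruction_iter2 unfolding linear_reconstruction_def orbit .
  have J: "invariant_integral grp chart proj iter2_dom iter2 quot_map int1"
    "invariant_integral grp chart proj iter2_dom iter2 quot_map int2"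
    using iter2_domD smooth_on_polynomial[OF polynomial_int1] smooth_on_int2
    by (auto intro!: invariant_integralI int1_iter2 int2_iter2 simp: int1_grp int2_grp reg2_iff)
  show ?thesis
    unfolding completely_integrable_def Let_def reg2
  proof (intro exI conjI)
    show "\<forall>t. \<forall>p\<in>reg2. grp t p \<in> reg2 \<and> (\<phi> \<circ> \<phi>) (grp t p) = grp t ((\<phi> \<circ> \<phi>) p)"
      using iter grp_reg2 iter2_grp by simp
    show "\<forall>p\<in>dom_within chart reg2 (\<phi> \<circ> \<phi>). proj ((\<phi> \<circ> \<phi>) p) = quot_map (proj p)"
      unfolding W using iterW proj_iter2 iter2_dom_iff by auto
    show "\<forall>p\<in>chart. 0 < m p" by (auto simp: chart_iff reg_def m_def)
  qed (use W mp int J rec one_parameter_group_grp quotient_projection_proj group_coordinate_coord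
      open_dense_iter2_dom smooth_on_m measure_preserving_grp measure_preserving_quot_map
      functionally_independent_int[OF assms(1)] in simp_all)
qed

end

section \<open>Reduction of the polar equation to coordinates\<close>

lemma unique_linear_solution_iff:
  fixes n :: "real^2^2"
  shows "(\<exists>!z. n *v z = x) \<longleftrightarrow> det n \<noteq> 0"
proof
  assume "\<exists>!z. n *v z = x"
  then obtain z where z: "n *v z = x" "\<And>z'. n *v z' = x \<Longrightarrow> z' = z" by auto
  \<comment> \<open>A kernel vector would produce a second solution, so uniqueness at a single
    right-hand side already forces injectivity.\<close>
  have "v = 0" if "n *v v = 0" for v
    using z(2)[of "z + v"] that z(1) by (simp add: matrix_vector_right_distrib)
  then have "inj ((*v) n)"
    by (simp add: linear_injective_0)
  then show "det n \<noteq> 0"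
    by (simp add: matrix_left_invertible_injective[symmetric] invertible_left_inverse[symmetric] invertible_det_nz)
next
  assume "det n \<noteq> 0"
  then show "\<exists>!z. n *v z = x"
    by (simp add: cramer)
qed

theorem corollary7:
  fixes H :: "real^2 \<Rightarrow> real"
    and HH :: "real^2 \<Rightarrow> real^2 \<Rightarrow> real^2 \<Rightarrow> real^2 \<Rightarrow> real"
    and K :: "real^2^2"
    and h :: real
  assumes "homogeneous_polynomial 4 H"
    and "\<exists>x. H x \<noteq> 0"
    and "symmetric_4linear HH"
    and "\<forall>x. H x = (1 / fact 4) * HH x x x x"
    and "invertible K"
    and "transpose K = - K"
    and "h \<noteq> 0"
  shows "completely_integrable (polar_dom h K HH) (polar_map h K HH)"
proof -
  have lin: "linear (\<lambda>a. HH a b c d)" and sym: "HH a b c d = HH b a c d" "HH a b c d = HH a c b d"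
    "HH a b c d = HH a b d c" for a b c d
    using assms(3) unfolding symmetric_4linear_def by blast+
  define e1 e2 where "e1 = (axis 1 1 :: real^2)" and "e2 = (axis 2 1 :: real^2)"
  have ev: "x = x $ 1 *\<^sub>R e1 + x $ 2 *\<^sub>R e2" for x :: "real^2"
    by (simp add: e1_def e2_def vec2_eq_iff axis_def)
  have s1: "HH x b c d = x $ 1 * HH e1 b c d + x $ 2 * HH e2 b c d" for x b c d
    using linear_add[OF lin, of "x $ 1 *\<^sub>R e1" "x $ 2 *\<^sub>R e2" b c d] linear_scale[OF lin, of _ _ b c d]
    by (subst ev[of x]) simp
  have s2: "HH b x c d = x $ 1 * HH b e1 c d + x $ 2 * HH b e2 c d" for x b c d
    using s1[of x b c d] sym(1) by simp
  have s3: "HH b c x d = x $ 1 * HH b c e1 d + x $ 2 * HH b c e2 d" for x b c d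
    using s2[of b x c d] sym(2) by simp
  have s4: "HH b c d x = x $ 1 * HH b c d e1 + x $ 2 * HH b c d e2" for x b c d
    using s3[of b c x d] sym(3) by simp
  define \<kappa> where "\<kappa> = K $ 1 $ 2"
  have "transpose K $ i $ j = - K $ i $ j" for i j using assms(6) by simp
  from this[of 1 1] this[of 2 2] this[of 2 1] have K: "K $ 1 $ 1 = 0" "K $ 2 $ 2 = 0" "K $ 2 $ 1 = - \<kappa>"
    by (simp_all add: transpose_def \<kappa>_def)
  have "\<kappa> \<noteq> 0" using assms(5) K by (auto simp: invertible_det_nz det_2 \<kappa>_def[symmetric])
  \<comment> \<open>\<open>K\<close> is \<open>\<kappa>\<close> times the standard rotation, and
    clearing \<open>2 * h\<close> against \<open>3!\<close> leaves \<open>h / 3\<close>;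
    \<open>r\<close> collects both factors.\<close>
  define r where "r = h * \<kappa> / 3"
  have r: "r \<noteq> 0" using \<open>\<kappa> \<noteq> 0\<close> assms(7) by (simp add: r_def)
  \<comment> \<open>By symmetry a value of \<open>HH\<close> on basis vectors depends only on how
    many of them are \<open>e2\<close>.\<close>
  define c where "c i = r * (if i = 0 then HH e1 e1 e1 e1 else if i = 1 then HH e1 e1 e1 e2
    else if i = 2 then HH e1 e1 e2 e2 else if i = 3 then HH e1 e2 e2 e2 else HH e2 e2 e2 e2)" for i :: nat
  interpret quartic c .
  have co: "co 0 x y = r * HH x y e1 e1" "co 1 x y = r * HH x y e1 e2"
    "co 2 x y = r * HH x y e2 e2" for x y
  proof -
    have perm: "HH e2 e1 a b = HH e1 e2 a b" "HH a e2 e1 b = HH a e1 e2 b" "HH a b e2 e1 = HH a b e1 e2" for a b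
      by (rule sym(1), rule sym(2), rule sym(3))
    show "co 0 x y = r * HH x y e1 e1" "co 1 x y = r * HH x y e1 e2"
      "co 2 x y = r * HH x y e2 e2"
      unfolding co_expand s1[of x] s2[of _ y] perm c_def by (simp_all add: perm algebra_simps)
  qed
  have eq: "polar_eq h K HH x y z \<longleftrightarrow> z - mv x y z = x" for x y z
  proof -
    have HHz: "r * HH x y z e1 = co 0 x y * z $ 1 + co 1 x y * z $ 2"
      "r * HH x y z e2 = co 1 x y * z $ 1 + co 2 x y * z $ 2"
      unfolding s3[of x y z] using co[of x y] by (simp_all add: sym(3)[of x y e2 e1] algebra_simps del: One_nat_def)
    have "polar_eq h K HH x y z \<longleftrightarrow> z - x = (h / 3) *\<^sub>R (K *v covector (\<lambda>v. HH x y z v))"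
    proof -
      have "z - x = (2 * h) *\<^sub>R ((1 / (2 * h)) *\<^sub>R (z - x))" using assms(7) by simp
      moreover have "(h / 3) *\<^sub>R w = (2 * h) *\<^sub>R ((1 / fact 3) *\<^sub>R w)" for w :: "real^2"
        by (simp add: fact_numeral)
      ultimately show ?thesis
        unfolding polar_eq_def using assms(7) by (metis scaleR_cancel_left mult_eq_0_iff zero_neq_numeral)
    qed
    also have "(h / 3) *\<^sub>R (K *v covector (\<lambda>v. HH x y z v)) = mv x y z"
      using HHz K by (simp add: vec2_eq_iff mv_nth matrix_vector_mult_def sum_2 covector_def r_def
        \<kappa>_def[symmetric] e1_def e2_def)
    finally show ?thesis by (auto simp: algebra_simps)
  qed
  have dom: "polar_dom h K HH = reg"
  proof -
    have "(\<exists>!z. z - mv x y z = x) \<longleftrightarrow> den x y \<noteq> 0" for x y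
    proof -
      have "matrix (\<lambda>v. v - mv x y v) *v z = z - mv x y z" for z
        by (subst matrix_works) (auto simp: linear_matrix_vector_mul_eq linear_id_minus_mv)
      then show ?thesis using unique_linear_solution_iff[of "matrix (\<lambda>v. v - mv x y v)" x] 
        by (simp add: det_id_minus_mv)
    qed
    then show ?thesis by (auto simp: polar_dom_def reg_def eq)
  qed
  have map: "polar_map h K HH p = step p" if "p \<in> reg" for p
    using that nxt_iff[of "fst p" "snd p"]
    by (simp add: polar_map_def step_def reg_def eq case_prod_unfold)
  obtain x where "H x \<noteq> 0" using assms(2) by blast
  then have "HH x x x x \<noteq> 0" using assms(4) by auto
  \<comment> \<open>So \<open>diag_form\<close> is a nonzero multiple of \<open>H\<close>; this is
    where \<open>H\<close> being nonzero yields independent integrals.\<close>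
  moreover have "diag_form x = r * HH x x x x"
    by (simp add: diag_form_def co s3[of x x x] s4[of x x _ x] power2_eq_square
        sym(3)[of x x e2 e1] algebra_simps del: One_nat_def)
  ultimately have "diag_form x \<noteq> 0" using r by simp
  from completely_integrable_step[OF this map] show ?thesis unfolding dom .
qed

end
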